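(* Let $\{U_k \colon k \in \mathbb{N}\}$ be a sequence of independent, identically distributed, non-negative random variables such that $\mathbb{P}\{U_1 = 0\} < 1$ and $\mathbb{E}[U_1^p] < \infty$ for some $p > 2$. Set $S_0 = 0$, $S_n = \sum_{k=1}^n U_k$ for $n \in \mathbb{N}$, and let $L = \{L(t) \colon t \geq 0\}$ be the renewal process $L(t) = \sum_{n=1}^\infty \mathbb{I}_{[0,t]}(S_n)$, where $\mathbb{I}_A$ denotes the indicator function of the set $A$. For $n \in \mathbb{N}$ define the process $X_n = \{X_n(t) \colon t \in [0,1]\}$ by \[ X_n(t) = C\sqrt{n} \int_0^t (-1)^{L(n u)}\, du, \] where $C > 0$ satisfies $C^2 = \mathbb{E}[U_1]/\mathrm{Var}(U_1)$. Then, as $n \to \infty$, the processes $X_n$ converge weakly (in distribution) in the space $\mathcal{C}([0,1])$ of continuous functions on $[0,1]$, endowed with the uniform topology, to a standard Brownian motion. *)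

theory Defs
  imports "HOL-Probability.Probability"
begin

definition renewal_S :: "(nat \<Rightarrow> 'a \<Rightarrow> real) \<Rightarrow> nat \<Rightarrow> 'a \<Rightarrow> real" where
  "renewal_S U n \<omega> = (\<Sum>k\<in>{1..n}. U k \<omega>)"

text \<open>Renewal process L(t) = sum over n >= 1 of the indicator of [0,t] at S_n, i.e. the number
  of n >= 1 with S_n in [0,t]. (It is finite almost surely; card of an infinite set is 0.)\<close>
definition renewal_L :: "(nat \<Rightarrow> 'a \<Rightarrow> real) \<Rightarrow> real \<Rightarrow> 'a \<Rightarrow> nat" where
  "renewal_L U t \<omega> = card {n::nat. 1 \<le> n \<and> 0 \<le> renewal_S U n \<omega> \<and> renewal_S U n \<omega> \<le> t}"

definition telegraph_X :: "(nat \<Rightarrow> 'a \<Rightarrow> real) \<Rightarrow> real \<Rightarrow> nat \<Rightarrow> 'a \<Rightarrow> real \<Rightarrow> real" where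
  "telegraph_X U C n \<omega> t =
     C * sqrt (real n) * integral {0..t} (\<lambda>u. (-1::real) ^ renewal_L U (real n * u) \<omega>)"

definition std_brownian_motion :: "'b measure \<Rightarrow> ('b \<Rightarrow> real \<Rightarrow> real) \<Rightarrow> bool" where
  "std_brownian_motion N B \<longleftrightarrow>
     prob_space N \<and>
     (\<forall>t\<in>{0..1}. (\<lambda>\<omega>. B \<omega> t) \<in> borel_measurable N) \<and>
     (\<forall>\<omega>\<in>space N. B \<omega> 0 = 0 \<and> continuous_on {0..1} (B \<omega>)) \<and>
     (\<forall>s t. 0 \<le> s \<and> s < t \<and> t \<le> 1 \<longrightarrow>
        distributed N lborel (\<lambda>\<omega>. B \<omega> t - B \<omega> s)
          (\<lambda>x. ennreal (normal_density 0 (sqrt (t - s)) x))) \<and>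
     (\<forall>(ts::nat \<Rightarrow> real) k. 0 \<le> ts 0 \<and> (\<forall>i<k. ts i < ts (Suc i)) \<and> ts k \<le> 1 \<longrightarrow>
        prob_space.indep_vars N (\<lambda>_. borel) (\<lambda>i \<omega>. B \<omega> (ts (Suc i)) - B \<omega> (ts i)) {..<k})"

text \<open>Bounded functionals on C([0,1]) that are continuous for the uniform topology
  (only their values on functions continuous on [0,1] matter).\<close>
definition bounded_cont_functional :: "((real \<Rightarrow> real) \<Rightarrow> real) \<Rightarrow> bool" where
  "bounded_cont_functional F \<longleftrightarrow>
     (\<exists>K. \<forall>f. continuous_on {0..1} f \<longrightarrow> \<bar>F f\<bar> \<le> K) \<and>
     (\<forall>f. continuous_on {0..1} f \<longrightarrow> (\<forall>e>0. \<exists>d>0. \<forall>g. continuous_on {0..1} g \<longrightarrow>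
        (\<forall>t\<in>{0..1}. \<bar>f t - g t\<bar> < d) \<longrightarrow> \<bar>F f - F g\<bar> < e))"

definition weak_conv_C01 ::
  "'a measure \<Rightarrow> (nat \<Rightarrow> 'a \<Rightarrow> real \<Rightarrow> real) \<Rightarrow> 'b measure \<Rightarrow> ('b \<Rightarrow> real \<Rightarrow> real) \<Rightarrow> bool" where
  "weak_conv_C01 M X N B \<longleftrightarrow>
     (\<forall>F. bounded_cont_functional F \<longrightarrow>
        (\<lambda>n. integral\<^sup>L M (\<lambda>\<omega>. F (X n \<omega>))) \<longlonglongrightarrow> integral\<^sup>L N (\<lambda>\<omega>. F (B \<omega>)))"

end

theory Submission
  imports Defs "HOL-Real_Asymp.Real_Asymp"
begin

text \<open>
  Put \<open>Y(v) = \<integral>\<^sub>0\<^sup>v (-1)\<^bsup>L(u)\<^esup> du\<close>, so that \<open>X\<^sub>n(t) = C Y(nt) / \<surd>n\<close>. At the even renewal epochs \<open>Y\<close> equals the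
  random walk \<open>W\<^sub>k\<close> with steps \<open>U\<^sub>2\<^sub>j\<^sub>+\<^sub>1 - U\<^sub>2\<^sub>j\<^sub>+\<^sub>2\<close>, and \<open>Y\<close> is 1-Lipschitz; hence \<open>X\<^sub>n\<close> is the walk up to
  the time change \<open>k \<mapsto> S\<^sub>2\<^sub>k\<close> and up to the largest waiting time. By the law of large numbers the
  time change is uniformly close to \<open>k \<mapsto> 2\<mu>k\<close>, and the moment of order \<open>p > 2\<close> makes the largest
  waiting time negligible against \<open>\<surd>n\<close>. Ottaviani's maximal inequality and the central limit theorem
  bound the modulus of continuity of \<open>W\<close>, so \<open>X\<^sub>n\<close> is uniformly close to the polygonal interpolation,
  on a grid of fixed mesh, of the rescaled walk. The increments of the latter are independent and
  converge to those of Brownian motion, jointly by applying Skorohod's theorem in each coordinate.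
  No tightness theorem is needed: an infimal convolution reduces the claim to bounded functionals
  that are Lipschitz for the uniform norm, for which these two approximations suffice.
\<close>

subsection \<open>Weak convergence of independent families\<close>

text \<open>The constant \<open>C\<close> is forced: a pair of waiting times has mean length
  \<open>2\<mu>\<close> and moves the walk by a step of variance \<open>2\<sigma>\<^sup>2\<close>,
  so about \<open>n / (2\<mu>)\<close> steps fall before time \<open>n\<close> and the limit has
  variance \<open>C\<^sup>2 * 2\<sigma>\<^sup>2 / (2\<mu>) = 1\<close> at time 1. The epochs and the
  walk are built from the same waiting times and are dependent. Hence the random clock is compared
  with the clock \<open>v / (2\<mu>)\<close> path by path, outside an event of small probability,
  and a distributional limit is taken only for the walk at deterministic indices. For the modulus
  Chebyshev's bound is too weak: \<open>1/\<theta>\<close> blocks, each bad with probability of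
  order \<theta>, do not add up to something small. The central limit theorem with the fourth moment
  of the normal law improves the order to \<open>\<theta>\<^sup>2\<close>, although the steps
  themselves may have no fourth moment. The order of choices is \<theta>, then the mesh
  \<open>1/m\<close>, then \<open>n\<close>. As \<open>m\<close> is fixed while \<open>n\<close>
  grows, only finitely many increments enter the limit.\<close>

lemma measurable_PiM_components:
  assumes "\<And>i. i \<in> I \<Longrightarrow> f i \<in> measurable (\<Omega> i) (N i)"
  shows "(\<lambda>\<omega>. \<lambda>i\<in>I. f i (\<omega> i)) \<in> measurable (PiM I \<Omega>) (PiM I N)"
proof (rule measurable_restrict)
  fix i assume i: "i \<in> I"
  show "(\<lambda>\<omega>. f i (\<omega> i)) \<in> measurable (PiM I \<Omega>) (N i)"
    using measurable_compose[OF measurable_component_singleton[OF i, of \<Omega>] assms[OF i]] .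
qed

lemma distr_PiM_components:
  assumes "finite I" "\<And>i. i \<in> I \<Longrightarrow> prob_space (\<Omega> i)"
    and f: "\<And>i. i \<in> I \<Longrightarrow> f i \<in> measurable (\<Omega> i) (N i)"
  shows "distr (PiM I \<Omega>) (PiM I N) (\<lambda>\<omega>. \<lambda>i\<in>I. f i (\<omega> i)) = PiM I (\<lambda>i. distr (\<Omega> i) (N i) (f i))"
proof -
  \<comment> \<open>The product locale wants a probability measure at every index, also outside
    \<open>I\<close>; the point mass is a filler that the product over \<open>I\<close> never
    sees.\<close>
  define \<Omega>' where "\<Omega>' i = (if i \<in> I then \<Omega> i else return (count_space UNIV) undefined)" for i
  define D where "D i = (if i \<in> I then distr (\<Omega> i) (N i) (f i) else return (count_space UNIV) undefined)" for i
  have ps: "prob_space (\<Omega>' i)" for i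
    using assms by (auto simp: \<Omega>'_def intro: prob_space_return)
  have pd: "prob_space (D i)" for i
    using assms by (auto simp: D_def intro: prob_space_return prob_space.prob_space_distr)
  interpret O: product_prob_space \<Omega>' I
    by (simp add: product_prob_space_def product_sigma_finite_def ps prob_space_imp_sigma_finite
      product_prob_space_axioms_def)
  interpret D: product_prob_space D I
    by (simp add: product_prob_space_def product_sigma_finite_def pd prob_space_imp_sigma_finite
      product_prob_space_axioms_def)
  have e1: "PiM I \<Omega> = PiM I \<Omega>'" by (intro PiM_cong) (auto simp: \<Omega>'_def)
  have e2: "PiM I (\<lambda>i. distr (\<Omega> i) (N i) (f i)) = PiM I D" by (intro PiM_cong) (auto simp: D_def)
  have f'[measurable]: "\<And>i. i \<in> I \<Longrightarrow> f i \<in> measurable (\<Omega>' i) (N i)" using f by (auto simp: \<Omega>'_def)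
  have e3: "sets (PiM I N) = sets (PiM I D)" by (intro sets_PiM_cong) (auto simp: D_def)
  have meas: "(\<lambda>\<omega>. \<lambda>i\<in>I. f i (\<omega> i)) \<in> measurable (PiM I \<Omega>') (PiM I N)"
    by (rule measurable_PiM_components) (rule f')
  have "distr (PiM I \<Omega>') (PiM I N) (\<lambda>\<omega>. \<lambda>i\<in>I. f i (\<omega> i)) = PiM I D"
  proof (rule D.PiM_eqI[OF \<open>finite I\<close>])
    show "sets (distr (PiM I \<Omega>') (PiM I N) (\<lambda>\<omega>. \<lambda>i\<in>I. f i (\<omega> i))) = sets (PiM I D)"
      by (simp add: e3)
    fix A assume A: "\<And>i. i \<in> I \<Longrightarrow> A i \<in> sets (D i)"
    then have A': "\<And>i. i \<in> I \<Longrightarrow> A i \<in> sets (N i)" by (simp add: D_def)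
    have "emeasure (distr (PiM I \<Omega>') (PiM I N) (\<lambda>\<omega>. \<lambda>i\<in>I. f i (\<omega> i))) (Pi\<^sub>E I A) =
      emeasure (PiM I \<Omega>') ((\<lambda>\<omega>. \<lambda>i\<in>I. f i (\<omega> i)) -` Pi\<^sub>E I A \<inter> space (PiM I \<Omega>'))"
      using A' assms(1) by (intro emeasure_distr meas sets_PiM_I_finite) auto
    also have "(\<lambda>\<omega>. \<lambda>i\<in>I. f i (\<omega> i)) -` Pi\<^sub>E I A \<inter> space (PiM I \<Omega>') =
      Pi\<^sub>E I (\<lambda>i. f i -` A i \<inter> space (\<Omega>' i))"
      by (auto simp: space_PiM PiE_iff extensional_def)
    also have "emeasure (PiM I \<Omega>') \<dots> = (\<Prod>i\<in>I. emeasure (\<Omega>' i) (f i -` A i \<inter> space (\<Omega>' i)))"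
      using A' assms(1) by (intro O.emeasure_PiM measurable_sets[OF f']) auto
    also have "\<dots> = (\<Prod>i\<in>I. emeasure (D i) (A i))"
      using A' f by (intro prod.cong) (auto simp: D_def \<Omega>'_def emeasure_distr)
    finally show "emeasure (distr (PiM I \<Omega>') (PiM I N) (\<lambda>\<omega>. \<lambda>i\<in>I. f i (\<omega> i))) (Pi\<^sub>E I A)
      = (\<Prod>i\<in>I. emeasure (D i) (A i))" .
  qed
  then show ?thesis by (simp add: e1 e2)
qed

text \<open>The hypothesis yields two facts. Convergence in the product topology is convergence at
  each coordinate, so \<open>G\<close> is continuous. A constant sequence \<open>x\<close> converges
  on \<open>I\<close> to every \<open>y\<close> that agrees with it there, so \<open>G\<close>
  ignores the other coordinates and is measurable for the product over \<open>I\<close>.\<close>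

lemma borel_measurable_seq_continuous:
  fixes G :: "(nat \<Rightarrow> real) \<Rightarrow> real"
  assumes "\<And>x y. (\<And>i. i \<in> I \<Longrightarrow> (\<lambda>n. x n i) \<longlonglongrightarrow> y i) \<Longrightarrow> (\<lambda>n. G (x n)) \<longlonglongrightarrow> G y"
  shows "G \<in> borel_measurable (PiM I (\<lambda>_. borel))"
proof -
  have "continuous_on UNIV G"
  proof (rule continuous_on_sequentiallyI)
    fix u a assume "(u::nat \<Rightarrow> nat \<Rightarrow> real) \<longlonglongrightarrow> a"
    then have "(\<lambda>n. u n i) \<longlonglongrightarrow> a i" for i
      by (rule continuous_on_tendsto_compose[OF continuous_on_product_coordinates[of i]]) auto
    then show "(\<lambda>n. G (u n)) \<longlonglongrightarrow> G a" by (intro assms)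
  qed
  then have G: "G \<in> borel_measurable borel" by (rule borel_measurable_continuous_onI)
  have "(\<lambda>x i. if i \<in> I then x i else 0) \<in> borel_measurable (PiM I (\<lambda>_. borel :: real measure))"
  proof (rule measurable_coordinatewise_then_product)
    fix i show "(\<lambda>x. if i \<in> I then x i else 0) \<in> borel_measurable (PiM I (\<lambda>_. borel :: real measure))"
      by (cases "i \<in> I") auto
  qed
  from measurable_compose[OF this G]
  have "(\<lambda>x. G (\<lambda>i. if i \<in> I then x i else 0)) \<in> borel_measurable (PiM I (\<lambda>_. borel))" .
  moreover have "G (\<lambda>i. if i \<in> I then x i else 0) = G x" for x
  proof -
    have "(\<lambda>n::nat. G x) \<longlonglongrightarrow> G (\<lambda>i. if i \<in> I then x i else 0)"
      by (rule assms) auto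
    from LIMSEQ_unique[OF this tendsto_const] show ?thesis by simp
  qed
  ultimately show ?thesis by simp
qed

text \<open>By independence the joint law is the product of the marginal laws, so the couplings that
  Skorohod's theorem gives for the single coordinates can be placed side by side on the product of
  their spaces without changing any integral. There the families converge pointwise, and bounded
  convergence applies.\<close>

lemma indep_vars_weak_limit:
  fixes D :: "nat \<Rightarrow> nat \<Rightarrow> 'a \<Rightarrow> real" and E :: "nat \<Rightarrow> 'b \<Rightarrow> real" and G :: "(nat \<Rightarrow> real) \<Rightarrow> real"
  assumes "prob_space M" "prob_space N" "finite I" "I \<noteq> {}"
    and D: "\<And>n. prob_space.indep_vars M (\<lambda>_. borel) (D n) I"
    and E: "prob_space.indep_vars N (\<lambda>_. borel) E I"
    and weak: "\<And>i. i \<in> I \<Longrightarrow> weak_conv_m (\<lambda>n. distr M borel (D n i)) (distr N borel (E i))"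
    and K: "\<And>x. \<bar>G x\<bar> \<le> K"
    and cont: "\<And>x y. (\<And>i. i \<in> I \<Longrightarrow> (\<lambda>n. x n i) \<longlonglongrightarrow> y i) \<Longrightarrow> (\<lambda>n. G (x n)) \<longlonglongrightarrow> G y"
  shows "(\<lambda>n. \<integral>\<omega>. G (\<lambda>i. D n i \<omega>) \<partial>M) \<longlonglongrightarrow> (\<integral>\<omega>. G (\<lambda>i. E i \<omega>) \<partial>N)"
proof -
  interpret M: prob_space M by fact
  interpret N: prob_space N by fact
  have Dm[measurable]: "D n i \<in> borel_measurable M" if "i \<in> I" for n i
    using D[of n] that unfolding M.indep_vars_def2 by auto
  have Em[measurable]: "E i \<in> borel_measurable N" if "i \<in> I" for i
    using E that unfolding N.indep_vars_def2 by auto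
  \<comment> \<open>The conjuncts follow the conclusion of \<open>Skorohod\<close> literally, so
    that it applies by resolution; \<open>bchoice\<close> then extracts the three witnesses one
    after the other.\<close>
  define Q where "Q i \<Omega> Ys Y \<longleftrightarrow>
    prob_space \<Omega> \<and>
    (\<forall>n. Ys n \<in> measurable \<Omega> borel) \<and>
    (\<forall>n. distr \<Omega> borel (Ys n) = distr M borel (D n i)) \<and>
    Y \<in> measurable \<Omega> lborel \<and>
    distr \<Omega> borel Y = distr N borel (E i) \<and>
    (\<forall>x \<in> space \<Omega>. (\<lambda>n. Ys n x) \<longlonglongrightarrow> Y x)" for i and \<Omega> :: "real measure" and Ys Y
  have "\<forall>i\<in>I. \<exists>\<Omega> Ys Y. Q i \<Omega> Ys Y"
    unfolding Q_def
    by (intro ballI Skorohod weak) (auto simp: real_distribution_def real_distribution_axioms_def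
       intro!: M.prob_space_distr N.prob_space_distr)
  from bchoice[OF this] obtain \<Omega> where "\<forall>i\<in>I. \<exists>Ys Y. Q i (\<Omega> i) Ys Y" by blast
  from bchoice[OF this] obtain Ys where "\<forall>i\<in>I. \<exists>Y. Q i (\<Omega> i) (Ys i) Y" by blast
  from bchoice[OF this] obtain Y where "\<forall>i\<in>I. Q i (\<Omega> i) (Ys i) (Y i)" by blast
  then have S: "\<And>i. i \<in> I \<Longrightarrow> prob_space (\<Omega> i)" "\<And>i n. i \<in> I \<Longrightarrow> Ys i n \<in> measurable (\<Omega> i) borel"
      "\<And>i n. i \<in> I \<Longrightarrow> distr (\<Omega> i) borel (Ys i n) = distr M borel (D n i)"
      "\<And>i. i \<in> I \<Longrightarrow> Y i \<in> measurable (\<Omega> i) borel"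
      "\<And>i. i \<in> I \<Longrightarrow> distr (\<Omega> i) borel (Y i) = distr N borel (E i)"
      "\<And>i x. i \<in> I \<Longrightarrow> x \<in> space (\<Omega> i) \<Longrightarrow> (\<lambda>n. Ys i n x) \<longlonglongrightarrow> Y i x"
    unfolding Q_def by auto
  have Gm[measurable]: "G \<in> borel_measurable (PiM I (\<lambda>_. borel))"
    by (rule borel_measurable_seq_continuous) (rule cont)
  have Gr: "G (restrict x I) = G x" for x
  proof -
    have "(\<lambda>n::nat. G x) \<longlonglongrightarrow> G (restrict x I)"
      by (rule cont) auto
    from LIMSEQ_unique[OF this tendsto_const] show ?thesis by simp
  qed
  interpret P: prob_space "PiM I \<Omega>" by (rule prob_space_PiM) (rule S)
  have m1[measurable]: "(\<lambda>\<omega>. \<lambda>i\<in>I. Ys i n (\<omega> i)) \<in> measurable (PiM I \<Omega>) (PiM I (\<lambda>_. borel))" for n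
    by (rule measurable_PiM_components) (rule S(2))
  have m2[measurable]: "(\<lambda>\<omega>. \<lambda>i\<in>I. Y i (\<omega> i)) \<in> measurable (PiM I \<Omega>) (PiM I (\<lambda>_. borel))"
    by (rule measurable_PiM_components) (rule S(4))
  have 1: "(\<integral>\<omega>. G (\<lambda>i. D n i \<omega>) \<partial>M) = (\<integral>\<omega>. G (\<lambda>i\<in>I. Ys i n (\<omega> i)) \<partial>PiM I \<Omega>)" for n
  proof -
    have "(\<integral>\<omega>. G (\<lambda>i. D n i \<omega>) \<partial>M) = (\<integral>\<omega>. G (\<lambda>i\<in>I. D n i \<omega>) \<partial>M)"
      using Gr[of "\<lambda>i. D n i _"] by simp
    also have "\<dots> = (\<integral>x. G x \<partial>distr M (PiM I (\<lambda>_. borel)) (\<lambda>\<omega>. \<lambda>i\<in>I. D n i \<omega>))"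
      by (subst integral_distr) (auto intro!: measurable_restrict)
    also have "distr M (PiM I (\<lambda>_. borel)) (\<lambda>\<omega>. \<lambda>i\<in>I. D n i \<omega>) = PiM I (\<lambda>i. distr M borel (D n i))"
      using D[of n] M.indep_vars_iff_distr_eq_PiM'[OF \<open>I \<noteq> {}\<close>, where X="D n" and M'="\<lambda>_. borel"] by auto
    also have "\<dots> = PiM I (\<lambda>i. distr (\<Omega> i) borel (Ys i n))"
      by (intro PiM_cong) (auto simp: S)
    also have "\<dots> = distr (PiM I \<Omega>) (PiM I (\<lambda>_. borel)) (\<lambda>\<omega>. \<lambda>i\<in>I. Ys i n (\<omega> i))"
      by (rule distr_PiM_components[symmetric]) (auto simp: S \<open>finite I\<close>)
    finally show ?thesis by (simp only: integral_distr[OF m1 Gm])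
  qed
  have 2: "(\<integral>\<omega>. G (\<lambda>i. E i \<omega>) \<partial>N) = (\<integral>\<omega>. G (\<lambda>i\<in>I. Y i (\<omega> i)) \<partial>PiM I \<Omega>)"
  proof -
    have "(\<integral>\<omega>. G (\<lambda>i. E i \<omega>) \<partial>N) = (\<integral>\<omega>. G (\<lambda>i\<in>I. E i \<omega>) \<partial>N)"
      using Gr[of "\<lambda>i. E i _"] by simp
    also have "\<dots> = (\<integral>x. G x \<partial>distr N (PiM I (\<lambda>_. borel)) (\<lambda>\<omega>. \<lambda>i\<in>I. E i \<omega>))"
      by (subst integral_distr) (auto intro!: measurable_restrict)
    also have "distr N (PiM I (\<lambda>_. borel)) (\<lambda>\<omega>. \<lambda>i\<in>I. E i \<omega>) = PiM I (\<lambda>i. distr N borel (E i))"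
      using E N.indep_vars_iff_distr_eq_PiM'[OF \<open>I \<noteq> {}\<close>, where X=E and M'="\<lambda>_. borel"] by auto
    also have "\<dots> = PiM I (\<lambda>i. distr (\<Omega> i) borel (Y i))"
      by (intro PiM_cong) (auto simp: S)
    also have "\<dots> = distr (PiM I \<Omega>) (PiM I (\<lambda>_. borel)) (\<lambda>\<omega>. \<lambda>i\<in>I. Y i (\<omega> i))"
      by (rule distr_PiM_components[symmetric]) (auto simp: S \<open>finite I\<close>)
    finally show ?thesis by (simp only: integral_distr[OF m2 Gm])
  qed
  have "(\<lambda>n. \<integral>\<omega>. G (\<lambda>i\<in>I. Ys i n (\<omega> i)) \<partial>PiM I \<Omega>) \<longlonglongrightarrow> (\<integral>\<omega>. G (\<lambda>i\<in>I. Y i (\<omega> i)) \<partial>PiM I \<Omega>)"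
  proof (rule integral_dominated_convergence[where w="\<lambda>_. K"])
    show "AE \<omega> in PiM I \<Omega>. (\<lambda>n. G (\<lambda>i\<in>I. Ys i n (\<omega> i))) \<longlonglongrightarrow> G (\<lambda>i\<in>I. Y i (\<omega> i))"
      by (intro AE_I2 cont) (auto intro!: S(6) simp: space_PiM)
  qed (use K in auto)
  then show ?thesis by (simp add: 1 2)
qed

text \<open>A Slutsky theorem for deterministic factors: on a Skorohod space
  \<open>c n * Ys n\<close> converges pointwise to \<open>c0 * Y\<close>, hence the characteristic
  functions converge. It absorbs the rounding of block lengths, which makes the scale factor only
  asymptotically constant.\<close>

lemma weak_conv_scaled:
  assumes "\<And>n. real_distribution (\<mu> n)" "real_distribution \<nu>" "weak_conv_m \<mu> \<nu>"
    and c: "c \<longlonglongrightarrow> (c0::real)"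
  shows "weak_conv_m (\<lambda>n. distr (\<mu> n) borel (\<lambda>x. c n * x)) (distr \<nu> borel (\<lambda>x. c0 * x))"
proof (rule levy_continuity)
  interpret mu: real_distribution "\<mu> n" for n by fact
  interpret nu: real_distribution \<nu> by fact
  show "real_distribution (distr (\<mu> n) borel (\<lambda>x. c n * x))" for n by simp
  show "real_distribution (distr \<nu> borel (\<lambda>x. c0 * x))" by simp
  fix t
  obtain \<Omega> :: "real measure" and Ys Y where
    S: "prob_space \<Omega>" "\<And>n. Ys n \<in> measurable \<Omega> borel"
      "\<And>n. distr \<Omega> borel (Ys n) = \<mu> n"
      "Y \<in> measurable \<Omega> borel"
      "distr \<Omega> borel Y = \<nu>"
      "\<And>x. x \<in> space \<Omega> \<Longrightarrow> (\<lambda>n. Ys n x) \<longlonglongrightarrow> Y x"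
    using Skorohod[OF assms(1-3)] by (simp only: measurable_lborel1 measurable_lborel2) metis
  interpret O: prob_space \<Omega> by fact
  note S(2,4)[measurable]
  have 1: "char (distr (\<mu> n) borel (\<lambda>x. c n * x)) t = (\<integral>x. iexp (t * (c n * Ys n x)) \<partial>\<Omega>)" for n
    unfolding char_def S(3)[symmetric] by (subst integral_distr; (subst integral_distr)?; simp)
  have 2: "char (distr \<nu> borel (\<lambda>x. c0 * x)) t = (\<integral>x. iexp (t * (c0 * Y x)) \<partial>\<Omega>)"
    unfolding char_def S(5)[symmetric] by (subst integral_distr; (subst integral_distr)?; simp)
  show "(\<lambda>n. char (distr (\<mu> n) borel (\<lambda>x. c n * x)) t) \<longlonglongrightarrow> char (distr \<nu> borel (\<lambda>x. c0 * x)) t"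
    unfolding 1 2
    by (rule integral_dominated_convergence[where w="\<lambda>_. 1"]) (auto intro!: tendsto_intros c S(6))
qed

subsection \<open>Sums of centred i.i.d. variables\<close>

text \<open>Kept apart from the renewal setting because two instances are needed: one for the walk,
  one for the centred even epochs.\<close>

locale iid_centered = prob_space M for M :: "'a measure" +
  fixes V :: "nat \<Rightarrow> 'a \<Rightarrow> real" and s :: real
  assumes indep: "indep_vars (\<lambda>_. borel) V UNIV"
    and same_distr: "distr M borel (V k) = distr M borel (V 0)"
    and square_int: "integrable M (\<lambda>\<omega>. (V 0 \<omega>)\<^sup>2)"
    and mean_zero: "expectation (V 0) = 0"
    and second_moment: "expectation (\<lambda>\<omega>. (V 0 \<omega>)\<^sup>2) = s\<^sup>2"
    and s_pos: "s > 0"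
begin

definition W :: "nat \<Rightarrow> 'a \<Rightarrow> real" where "W k \<omega> = (\<Sum>j<k. V j \<omega>)"

lemma V_meas[measurable]: "V k \<in> borel_measurable M"
  using indep unfolding indep_vars_def2 by auto

lemma W_meas[measurable]: "W k \<in> borel_measurable M"
  unfolding W_def[abs_def] by measurable

lemma expectation_V:
  fixes f :: "real \<Rightarrow> real" assumes [measurable]: "f \<in> borel_measurable borel"
  shows "expectation (\<lambda>\<omega>. f (V k \<omega>)) = expectation (\<lambda>\<omega>. f (V 0 \<omega>))"
proof -
  have "expectation (\<lambda>\<omega>. f (V k \<omega>)) = (\<integral>x. f x \<partial>distr M borel (V k))"
    by (simp add: integral_distr)
  also have "\<dots> = expectation (\<lambda>\<omega>. f (V 0 \<omega>))"
    by (simp add: integral_distr same_distr[of k])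
  finally show ?thesis .
qed

lemma integrable_V:
  fixes f :: "real \<Rightarrow> real" assumes [measurable]: "f \<in> borel_measurable borel"
  shows "integrable M (\<lambda>\<omega>. f (V k \<omega>)) \<longleftrightarrow> integrable M (\<lambda>\<omega>. f (V 0 \<omega>))"
proof -
  have "integrable M (\<lambda>\<omega>. f (V k \<omega>)) \<longleftrightarrow> integrable (distr M borel (V k)) f"
    by (simp add: integrable_distr_eq)
  also have "\<dots> \<longleftrightarrow> integrable M (\<lambda>\<omega>. f (V 0 \<omega>))"
    by (simp add: integrable_distr_eq same_distr[of k])
  finally show ?thesis .
qed

lemma V_square_int: "integrable M (\<lambda>\<omega>. (V k \<omega>)\<^sup>2)"
  using integrable_V[of "\<lambda>x. x\<^sup>2"] square_int by simp

lemma V_int: "integrable M (V k)"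
  by (rule square_integrable_imp_integrable[OF _ V_square_int]) simp

lemma V_mean: "expectation (V k) = 0"
  using expectation_V[of "\<lambda>x. x"] mean_zero by simp

lemma V_second_moment: "expectation (\<lambda>\<omega>. (V k \<omega>)\<^sup>2) = s\<^sup>2"
  using expectation_V[of "\<lambda>x. x\<^sup>2"] second_moment by simp

lemma sum_second_moment:
  assumes "finite A"
  shows "integrable M (\<lambda>\<omega>. (\<Sum>j\<in>A. V j \<omega>)\<^sup>2) \<and>
    expectation (\<lambda>\<omega>. (\<Sum>j\<in>A. V j \<omega>)\<^sup>2) = card A * s\<^sup>2"
  using assms
proof (induction A rule: finite_induct)
  case (insert x F)
  let ?S = "\<lambda>\<omega>. \<Sum>j\<in>F. V j \<omega>"
  have ind: "indep_var borel (V x) borel ?S"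
    by (rule indep_vars_sum[OF insert(1,2) indep_vars_subset[OF indep]]) auto
  have iS: "integrable M ?S" by (auto intro: V_int)
  note prod = indep_var_integrable[OF ind V_int iS]
  have e: "(\<Sum>j\<in>insert x F. V j \<omega>)\<^sup>2 = (V x \<omega>)\<^sup>2 + 2 * (V x \<omega> * ?S \<omega>) + (?S \<omega>)\<^sup>2" for \<omega>
    using insert(1,2) by (simp add: power2_sum)
  have 1: "integrable M (\<lambda>\<omega>. (\<Sum>j\<in>insert x F. V j \<omega>)\<^sup>2)"
    unfolding e using prod insert V_square_int by auto
  have "expectation (\<lambda>\<omega>. (\<Sum>j\<in>insert x F. V j \<omega>)\<^sup>2) =
     expectation (\<lambda>\<omega>. (V x \<omega>)\<^sup>2) + 2 * (expectation (V x) * expectation ?S) + expectation (\<lambda>\<omega>. (?S \<omega>)\<^sup>2)"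
    unfolding e using prod insert V_square_int
    by (simp add: indep_var_lebesgue_integral[OF ind V_int iS])
  also have "\<dots> = card (insert x F) * s\<^sup>2"
    using insert by (simp add: V_mean V_second_moment algebra_simps)
  finally show ?case using 1 by blast
qed auto

lemma sum_Chebyshev:
  assumes "finite A" "x > 0"
  shows "prob {\<omega>\<in>space M. \<bar>\<Sum>j\<in>A. V j \<omega>\<bar> > x} \<le> card A * s\<^sup>2 / x\<^sup>2"
proof -
  have "prob {\<omega>\<in>space M. \<bar>\<Sum>j\<in>A. V j \<omega>\<bar> > x} \<le> prob {\<omega>\<in>space M. (\<Sum>j\<in>A. V j \<omega>)\<^sup>2 \<ge> x\<^sup>2}"
  proof (intro finite_measure_mono)
    show "{\<omega> \<in> space M. x < \<bar>\<Sum>j\<in>A. V j \<omega>\<bar>} \<subseteq> {\<omega> \<in> space M. x\<^sup>2 \<le> (\<Sum>j\<in>A. V j \<omega>)\<^sup>2}"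
      using \<open>x > 0\<close> by (auto simp: abs_le_square_iff[symmetric])
  qed measurable
  also have "\<dots> \<le> expectation (\<lambda>\<omega>. (\<Sum>j\<in>A. V j \<omega>)\<^sup>2) / x\<^sup>2"
    using assms by (intro integral_Markov_inequality_measure[where A="{}"] conjunct1[OF sum_second_moment]) auto
  finally show ?thesis by (simp add: sum_second_moment assms)
qed

text \<open>By independence and equal laws, the characteristic function of a sum over
  \<open>A\<close> is a power with exponent \<open>card A\<close>, so the law of a block depends on
  its length only.\<close>

lemma block_distr:
  "distr M borel (\<lambda>\<omega>. \<Sum>j\<in>{a..<a+r}. V j \<omega>) = distr M borel (W r)"
proof (rule Levy_uniqueness)
  show "char (distr M borel (\<lambda>\<omega>. \<Sum>j\<in>{a..<a+r}. V j \<omega>)) = char (distr M borel (W r))"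
  proof
    fix t
    have 1: "char (distr M borel (V j)) t = char (distr M borel (V 0)) t" for j
      by (rule arg_cong[OF same_distr, of "\<lambda>\<mu>. char \<mu> t"])
    have 2: "char (distr M borel (\<lambda>\<omega>. \<Sum>j\<in>A. V j \<omega>)) t = char (distr M borel (V 0)) t ^ card A" for A
    proof -
      have "char (distr M borel (\<lambda>\<omega>. \<Sum>j\<in>A. V j \<omega>)) t = (\<Prod>j\<in>A. char (distr M borel (V j)) t)"
        by (rule char_distr_sum[OF indep_vars_subset[OF indep subset_UNIV]])
      also have "\<dots> = (\<Prod>j\<in>A. char (distr M borel (V 0)) t)" by (intro prod.cong refl 1)
      finally show ?thesis by simp
    qed
    show "char (distr M borel (\<lambda>\<omega>. \<Sum>j\<in>{a..<a+r}. V j \<omega>)) t = char (distr M borel (W r)) t"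
      unfolding W_def[abs_def] 2 by simp
  qed
qed (auto simp: real_distribution_def real_distribution_axioms_def intro!: prob_space_distr)

lemma prob_block:
  "prob {\<omega>\<in>space M. \<bar>\<Sum>j\<in>{a..<a+r}. V j \<omega>\<bar> > x} = prob {\<omega>\<in>space M. \<bar>W r \<omega>\<bar> > x}"
proof -
  have "measure (distr M borel (\<lambda>\<omega>. \<Sum>j\<in>{a..<a+r}. V j \<omega>)) {y. \<bar>y\<bar> > x} =
     measure (distr M borel (W r)) {y. \<bar>y\<bar> > x}" by (simp add: block_distr)
  then show ?thesis
    by (simp add: measure_distr vimage_def Int_def conj_commute)
qed

text \<open>Decompose according to the first passage above \<open>2x\<close>: the remaining sum is independent of it and
  is at most \<open>x\<close> in absolute value with probability at least one half.\<close>

lemma Ottaviani: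
  assumes x: "x > 0" and small: "r * s\<^sup>2 / x\<^sup>2 \<le> 1/2"
  shows "prob {\<omega>\<in>space M. \<exists>i\<le>r. \<bar>\<Sum>j\<in>{a..<a+i}. V j \<omega>\<bar> > 2 * x} \<le> 2 * prob {\<omega>\<in>space M. \<bar>W r \<omega>\<bar> > x}"
proof -
  define B where "B i \<omega> = (\<Sum>j\<in>{a..<a+i}. V j \<omega>)" for i \<omega>
  have [measurable]: "B i \<in> borel_measurable M" for i unfolding B_def[abs_def] by measurable
  define A where "A i = {\<omega>\<in>space M. \<bar>B i \<omega>\<bar> > 2 * x \<and> (\<forall>i'<i. \<bar>B i' \<omega>\<bar> \<le> 2 * x)}" for i
  define H where "H i = {\<omega>\<in>space M. \<bar>B r \<omega> - B i \<omega>\<bar> \<le> x}" for i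
  have [measurable]: "A i \<in> sets M" "H i \<in> sets M" for i unfolding A_def H_def by measurable
  have disj: "disjoint_family_on A {..r}"
    unfolding disjoint_family_on_def A_def
  proof (safe)
    fix m n \<omega> assume "m \<noteq> n" "2 * x < \<bar>B m \<omega>\<bar>" "\<forall>i'<m. \<bar>B i' \<omega>\<bar> \<le> 2 * x"
      "2 * x < \<bar>B n \<omega>\<bar>" "\<forall>i'<n. \<bar>B i' \<omega>\<bar> \<le> 2 * x"
    then show "\<omega> \<in> {}" by (metis linorder_neqE_nat not_le)
  qed
  have un: "{\<omega>\<in>space M. \<exists>i\<le>r. \<bar>B i \<omega>\<bar> > 2 * x} = (\<Union>i\<in>{..r}. A i)"
  proof (safe)
    fix \<omega> i assume w: "\<omega> \<in> space M" and i: "i \<le> r" "2 * x < \<bar>B i \<omega>\<bar>"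
    define k where "k = (LEAST k. 2 * x < \<bar>B k \<omega>\<bar>)"
    have "2 * x < \<bar>B k \<omega>\<bar>" unfolding k_def by (rule LeastI) (rule i)
    moreover have "k \<le> i" unfolding k_def by (rule Least_le) (rule i)
    moreover have "\<bar>B j \<omega>\<bar> \<le> 2 * x" if "j < k" for j
      using not_less_Least[OF that[unfolded k_def]] by simp
    ultimately have "\<omega> \<in> A k" "k \<in> {..r}" using w i by (auto simp: A_def)
    then show "\<omega> \<in> (\<Union>i\<in>{..r}. A i)" by blast
  qed (auto simp: A_def)
  have split: "B r \<omega> - B i \<omega> = (\<Sum>j\<in>{a+i..<a+r}. V j \<omega>)" if "i \<le> r" for i \<omega>
    unfolding B_def using that sum_diff_nat_ivl[of a "a+i" "a+r" "\<lambda>j. V j \<omega>"] by simp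
  \<comment> \<open>\<open>A i\<close> is decided by the coordinates in \<open>?I\<close> and
    \<open>H i\<close> by those in \<open>?J\<close>. Both are written as preimages under the
    restrictions to these disjoint index sets, which are independent.\<close>
  have ind: "prob (A i \<inter> H i) = prob (A i) * prob (H i)" if i: "i \<le> r" for i
  proof -
    let ?I = "{a..<a+i}" and ?J = "{a+i..<a+r}"
    let ?P = "\<lambda>I. PiM I (\<lambda>_. borel :: real measure)"
    let ?SA = "{y\<in>space (?P ?I). \<bar>\<Sum>j\<in>{a..<a+i}. y j\<bar> > 2 * x \<and> (\<forall>i'\<in>{..<i}. \<bar>\<Sum>j\<in>{a..<a+i'}. y j\<bar> \<le> 2 * x)}"
    let ?SB = "{y\<in>space (?P ?J). \<bar>\<Sum>j\<in>?J. y j\<bar> \<le> x}"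
    have iv: "indep_var (?P ?I) (\<lambda>\<omega>. restrict (\<lambda>j. V j \<omega>) ?I) (?P ?J) (\<lambda>\<omega>. restrict (\<lambda>j. V j \<omega>) ?J)"
      by (rule indep_var_restrict[OF indep]) auto
    have 1: "?SA \<in> sets (?P ?I)"
    proof -
      have [measurable]: "(\<lambda>y. \<Sum>j\<in>{a..<a+i'}. y j) \<in> borel_measurable (?P ?I)" if "i' \<le> i" for i'
        using that by (intro borel_measurable_sum measurable_component_singleton) auto
      have [measurable]: "(\<lambda>y. \<Sum>j\<in>{a..<a+i'}. y j) \<in> borel_measurable (?P ?I)" if "i' \<in> {..<i}" for i'
        using that by (intro borel_measurable_sum measurable_component_singleton) auto
      show ?thesis by measurable
    qed
    have 2: "?SB \<in> sets (?P ?J)" by measurable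
    have eA: "(\<lambda>\<omega>. restrict (\<lambda>j. V j \<omega>) ?I) -` ?SA \<inter> space M = A i"
    proof -
      have "(\<Sum>j\<in>{a..<a+i'}. restrict (\<lambda>j. V j \<omega>) ?I j) = B i' \<omega>" if "i' \<le> i" for i' \<omega>
        unfolding B_def using that by (intro sum.cong) auto
      then show ?thesis unfolding A_def by (auto simp: space_PiM)
    qed
    have eH: "(\<lambda>\<omega>. restrict (\<lambda>j. V j \<omega>) ?J) -` ?SB \<inter> space M = H i"
      unfolding H_def by (auto simp: space_PiM split[OF i])
    have "(\<lambda>\<omega>. (restrict (\<lambda>j. V j \<omega>) ?I, restrict (\<lambda>j. V j \<omega>) ?J)) -` (?SA \<times> ?SB) \<inter> space M = A i \<inter> H i"
      using eA eH by blast
    with indep_varD[OF iv 1 2] eA eH show ?thesis by simp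
  qed
  \<comment> \<open>The sum in \<open>H i\<close> has at most \<open>r\<close> terms, so the
    Chebyshev bound and \<open>small\<close> work for every \<open>i\<close> at once.\<close>
  have half: "prob (H i) \<ge> 1/2" if i: "i \<le> r" for i
  proof -
    have "prob {\<omega>\<in>space M. \<bar>B r \<omega> - B i \<omega>\<bar> > x} \<le> real (card {a+i..<a+r}) * s\<^sup>2 / x\<^sup>2"
      unfolding split[OF i] by (rule sum_Chebyshev) (use x in auto)
    also have "\<dots> \<le> r * s\<^sup>2 / x\<^sup>2"
      by (intro divide_right_mono mult_right_mono) auto
    finally have *: "prob {\<omega>\<in>space M. \<bar>B r \<omega> - B i \<omega>\<bar> > x} \<le> 1/2"
      using small by linarith
    have "space M - H i = {\<omega>\<in>space M. \<bar>B r \<omega> - B i \<omega>\<bar> > x}"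
      unfolding H_def by auto
    with * have "prob (space M - H i) \<le> 1/2" by simp
    moreover have "prob (space M - H i) = 1 - prob (H i)" by (rule prob_compl) simp
    ultimately show ?thesis by linarith
  qed
  have sub: "A i \<inter> H i \<subseteq> {\<omega>\<in>space M. \<bar>B r \<omega>\<bar> > x}" for i
  proof
    fix \<omega> assume "\<omega> \<in> A i \<inter> H i"
    then have "\<omega> \<in> space M" "\<bar>B i \<omega>\<bar> > 2 * x" "\<bar>B r \<omega> - B i \<omega>\<bar> \<le> x"
      by (simp_all add: A_def H_def)
    then show "\<omega> \<in> {\<omega>\<in>space M. \<bar>B r \<omega>\<bar> > x}" by simp
  qed
  have "prob {\<omega>\<in>space M. \<exists>i\<le>r. \<bar>B i \<omega>\<bar> > 2 * x} = (\<Sum>i\<in>{..r}. prob (A i))"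
    unfolding un by (rule finite_measure_finite_Union[OF _ _ disj]) auto
  also have "\<dots> \<le> (\<Sum>i\<in>{..r}. 2 * prob (A i \<inter> H i))"
  proof (intro sum_mono)
    fix i assume "i \<in> {..r}"
    then show "prob (A i) \<le> 2 * prob (A i \<inter> H i)"
      using ind[of i] mult_left_mono[OF half[of i], of "prob (A i)"] by simp
  qed
  also have "\<dots> = 2 * (\<Sum>i\<in>{..r}. prob (A i \<inter> H i))" by (simp add: sum_distrib_left)
  also have "(\<Sum>i\<in>{..r}. prob (A i \<inter> H i)) = prob (\<Union>i\<in>{..r}. A i \<inter> H i)"
    by (rule finite_measure_finite_Union[symmetric])
       (use disj in \<open>auto simp: disjoint_family_on_def\<close>)
  also have "\<dots> \<le> prob {\<omega>\<in>space M. \<bar>B r \<omega>\<bar> > x}"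
    using sub by (intro finite_measure_mono) auto
  also have "\<dots> = prob {\<omega>\<in>space M. \<bar>W r \<omega>\<bar> > x}" unfolding B_def by (rule prob_block)
  finally show ?thesis by (simp add: B_def)
qed

lemma CLT:
  "weak_conv_m (\<lambda>r. distr M borel (\<lambda>\<omega>. W r \<omega> / sqrt (r * s\<^sup>2))) std_normal_distribution"
  unfolding W_def
  by (rule central_limit_theorem_zero_mean[OF indep V_mean s_pos V_square_int _ same_distr])
     (simp add: V_mean V_second_moment)

text \<open>The fourth moment of the standard normal law is 3; any bound of order \<open>o(y\<^sup>-\<^sup>2)\<close> would do for the
  modulus of continuity, where the number of blocks grows like \<open>y\<^sup>2\<close>.\<close>

lemma tail_W:
  assumes y: "y > 0"
  shows "eventually (\<lambda>r. prob {\<omega>\<in>space M. \<bar>W r \<omega>\<bar> > y * s * sqrt r} \<le> 4 / y^4) sequentially"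
proof -
  \<comment> \<open>A bounded continuous function between the indicator of
    \<open>\<bar>x\<bar> > y\<close> and \<open>x^4 / y^4\<close>. The truncation at 1 is what lets
    weak convergence apply, with no moment beyond the second assumed for the steps.\<close>
  define f where "f x = min 1 (x^4 / y^4)" for x :: real
  define \<mu> where "\<mu> r = distr M borel (\<lambda>\<omega>. W r \<omega> / sqrt (r * s\<^sup>2))" for r :: nat
  interpret N: prob_space std_normal_distribution
    by (rule real_distribution.axioms(1)[OF real_dist_normal_dist])
  have f01: "0 \<le> f x" "f x \<le> 1" for x by (auto simp: f_def)
  have fc: "isCont f x" for x unfolding f_def using y by (intro continuous_intros) auto
  have fm[measurable]: "f \<in> borel_measurable borel" unfolding f_def by measurable
  have lim: "(\<lambda>r. \<integral>x. f x \<partial>\<mu> r) \<longlonglongrightarrow> (\<integral>x. f x \<partial>std_normal_distribution)"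
    using CLT unfolding \<mu>_def
    by (intro weak_conv_imp_integral_bdd_continuous_conv[where B=1] fc real_dist_normal_dist)
       (auto simp: real_distribution_def real_distribution_axioms_def f01 abs_of_nonneg intro!: prob_space_distr)
  have m4: "has_bochner_integral lborel (\<lambda>x. std_normal_density x * x ^ (2 * 2)) (fact (2 * 2) / (2 ^ 2 * fact 2))"
    by (rule std_normal_moment_even)
  have i4: "integrable std_normal_distribution (\<lambda>x. x^4)"
    using m4 by (subst integrable_density) (auto simp: has_bochner_integral_iff)
  have e4: "(\<integral>x. x^4 \<partial>std_normal_distribution) = 3"
    using m4 by (subst integral_density) (auto simp: has_bochner_integral_iff fact_numeral)
  have "(\<integral>x. f x \<partial>std_normal_distribution) \<le> (\<integral>x. x^4 / y^4 \<partial>std_normal_distribution)"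
  proof (rule integral_mono)
    show "integrable std_normal_distribution f"
      by (rule N.integrable_const_bound[where B=1]) (auto simp: f01 abs_of_nonneg)
  qed (use i4 in \<open>auto simp: f_def\<close>)
  also have "\<dots> = 3 / y^4" using e4 by simp
  \<comment> \<open>The strict gap between 3 and 4 is what carries the bound from the limit to all
    large \<open>r\<close>.\<close>
  also have "\<dots> < 4 / y^4" using y by (intro divide_strict_right_mono) auto
  finally have "eventually (\<lambda>r. (\<integral>x. f x \<partial>\<mu> r) < 4 / y^4) sequentially"
    using lim order_tendstoD(2) by blast
  then show ?thesis using eventually_gt_at_top[of 0]
  proof eventually_elim
    case (elim r)
    let ?Z = "\<lambda>\<omega>. W r \<omega> / sqrt (r * s\<^sup>2)"
    have sq: "sqrt (r * s\<^sup>2) = s * sqrt r" using s_pos by (simp add: real_sqrt_mult)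
    have "prob {\<omega>\<in>space M. \<bar>W r \<omega>\<bar> > y * s * sqrt r} = expectation (\<lambda>\<omega>. indicator {\<omega>\<in>space M. \<bar>W r \<omega>\<bar> > y * s * sqrt r} \<omega>)"
      by (subst Bochner_Integration.integral_indicator) (auto intro!: arg_cong[where f=prob])
    also have "\<dots> \<le> expectation (\<lambda>\<omega>. f (?Z \<omega>))"
    proof (intro integral_mono)
      show "integrable M (\<lambda>\<omega>. f (?Z \<omega>))" by (intro integrable_const_bound[where B=1]) (auto simp: f01 abs_of_nonneg)
      show "integrable M (\<lambda>\<omega>. indicator {\<omega>\<in>space M. \<bar>W r \<omega>\<bar> > y * s * sqrt r} \<omega> :: real)"
        by (intro integrable_const_bound[where B=1]) auto
      fix \<omega> assume "\<omega> \<in> space M"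
      show "indicator {\<omega>\<in>space M. \<bar>W r \<omega>\<bar> > y * s * sqrt r} \<omega> \<le> f (?Z \<omega>)"
      proof (cases "\<bar>W r \<omega>\<bar> > y * s * sqrt r")
        case True
        have "y < \<bar>?Z \<omega>\<bar>" unfolding sq using True elim s_pos
          by (simp add: abs_mult pos_less_divide_eq mult_ac)
        then have "y^4 \<le> \<bar>?Z \<omega>\<bar>^4" using y by (intro power_mono) auto
        also have "\<dots> = (?Z \<omega>)^4" by (rule power_even_abs) simp
        finally have "y^4 \<le> (?Z \<omega>)^4" .
        then have "1 \<le> (?Z \<omega>)^4 / y^4" using y by (simp add: le_divide_eq del: power_divide)
        then have "f (?Z \<omega>) = 1" unfolding f_def by (rule min_absorb1)
        then show ?thesis by (simp add: indicator_def)
      qed (simp add: f01)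
    qed
    also have "\<dots> = (\<integral>x. f x \<partial>\<mu> r)" unfolding \<mu>_def by (simp add: integral_distr)
    finally show ?case using elim by simp
  qed
qed

end

section \<open>Uniform law of large numbers, modulus of continuity and limit of the
  increments\<close>

context iid_centered begin

lemma W_diff:
  assumes "j \<le> k"
  shows "W k \<omega> - W j \<omega> = (\<Sum>i\<in>{j..<k}. V i \<omega>)"
  unfolding W_def lessThan_atLeast0 using assms
  by (metis le0 sum_diff_nat_ivl)

text \<open>Ottaviani with \<open>x = \<delta> * n / 2\<close> reduces the maximum to its last term,
  whose Chebyshev bound is of order \<open>1/n\<close>. That bound has to fall below
  \<open>1/2\<close> to meet the hypothesis of \<open>Ottaviani\<close> and below
  \<open>\<eta>/2\<close> to pay for its factor 2.\<close>

lemma W_uniform_LLN: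
  fixes \<delta> \<kappa> \<eta> :: real
  assumes "\<delta> > 0" "\<kappa> > 0" "\<eta> > 0"
  shows "eventually (\<lambda>n. prob {\<omega>\<in>space M. \<exists>k\<le>nat \<lceil>\<kappa> * real n\<rceil>. \<bar>W k \<omega>\<bar> > \<delta> * n} \<le> \<eta>) sequentially"
proof -
  have "(\<lambda>n. (\<kappa> * real n + 1) * s\<^sup>2 / (\<delta> * n / 2)\<^sup>2) \<longlonglongrightarrow> 0"
    using assms s_pos by real_asymp
  then have "eventually (\<lambda>n. (\<kappa> * real n + 1) * s\<^sup>2 / (\<delta> * n / 2)\<^sup>2 < min (1/2) (\<eta>/2)) sequentially"
    using assms by (intro order_tendstoD) auto
  then show ?thesis using eventually_gt_at_top[of 0]
  proof eventually_elim
    case (elim n)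
    let ?r = "nat \<lceil>\<kappa> * real n\<rceil>" and ?x = "\<delta> * n / 2"
    have r: "real ?r \<le> \<kappa> * n + 1" using assms by (simp add: of_nat_nat)
    have x: "?x > 0" using assms elim by simp
    have lt: "(\<kappa> * real n + 1) * s\<^sup>2 / ?x\<^sup>2 < 1/2" "(\<kappa> * real n + 1) * s\<^sup>2 / ?x\<^sup>2 < \<eta>/2"
      using elim(1) by (simp_all only: min_less_iff_conj)
    have b: "real ?r * s\<^sup>2 / ?x\<^sup>2 \<le> (\<kappa> * real n + 1) * s\<^sup>2 / ?x\<^sup>2"
      by (intro divide_right_mono mult_right_mono r) auto
    have "prob {\<omega>\<in>space M. \<exists>i\<le>?r. \<bar>\<Sum>j\<in>{0..<0+i}. V j \<omega>\<bar> > 2 * ?x} \<le> 2 * prob {\<omega>\<in>space M. \<bar>W ?r \<omega>\<bar> > ?x}"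
      by (rule Ottaviani[OF x]) (use lt b in linarith)
    also have "prob {\<omega>\<in>space M. \<bar>W ?r \<omega>\<bar> > ?x} \<le> real ?r * s\<^sup>2 / ?x\<^sup>2"
      using sum_Chebyshev[OF _ x, of "{..<?r}"] by (simp add: W_def)
    also have "\<dots> \<le> \<eta> / 2" using lt b by linarith
    finally show ?case by (simp add: W_def lessThan_atLeast0)
  qed
qed

text \<open>The indices up to \<open>\<kappa> * n\<close> are cut into about
  \<open>\<kappa>/\<theta>\<close> blocks of length about \<open>\<theta> * n\<close>. By
  \<open>Ottaviani\<close> and \<open>tail_W\<close> each block oscillates too much with probability
  at most of order \<open>\<theta>\<^sup>2\<close>, so the union bound is of order \<theta>.\<close>

lemma W_modulus:
  fixes \<epsilon> \<kappa> \<eta> :: real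
  assumes "\<epsilon> > 0" "\<kappa> > 0" "\<eta> > 0"
  shows "\<exists>\<theta>::real. \<theta> > 0 \<and> eventually (\<lambda>n. \<exists>A\<in>sets M. prob A \<le> \<eta> \<and>
    (\<forall>\<omega>\<in>space M - A. \<forall>j k. real j \<le> \<kappa> * n \<longrightarrow> real k \<le> \<kappa> * n \<longrightarrow> \<bar>real j - real k\<bar> \<le> \<theta> * n
       \<longrightarrow> \<bar>W j \<omega> - W k \<omega>\<bar> \<le> \<epsilon> * sqrt n)) sequentially"
proof -
  \<comment> \<open>\<open>5184 = 4 * 6^4\<close>, which turns \<open>4 / y^4\<close> into
    \<open>4 * c * \<theta>\<^sup>2\<close> for the \<open>y\<close> chosen below.\<close>
  define c where "c = 5184 * s^4 / \<epsilon>^4"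
  have c: "c > 0" using assms s_pos by (simp add: c_def)
  \<comment> \<open>The bound 1 lets \<open>\<theta>\<^sup>2\<close> be replaced by \<theta> in the
    total. The second entry makes this total at most \<eta>. The third gives
    \<open>r * s\<^sup>2 / x\<^sup>2 \<le> 1/2\<close>, as \<open>Ottaviani\<close> demands.\<close>
  define \<theta> where "\<theta> = min 1 (min (\<eta> / (8 * c * (\<kappa> + 2))) (\<epsilon>\<^sup>2 / (144 * s\<^sup>2)))"
  have \<theta>: "\<theta> > 0" "\<theta> \<le> 1" "\<theta> \<le> \<eta> / (8 * c * (\<kappa> + 2))" "\<theta> \<le> \<epsilon>\<^sup>2 / (144 * s\<^sup>2)"
    using assms s_pos c by (auto simp: \<theta>_def)
  \<comment> \<open>Solves \<open>y * s * sqrt (2 * \<theta> * n) = \<epsilon> * sqrt n / 6\<close>,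
    where \<open>2 * \<theta> * n\<close> bounds the block length.\<close>
  define y where "y = \<epsilon> / (6 * s * sqrt (2 * \<theta>))"
  have y: "y > 0" using assms s_pos \<theta> by (simp add: y_def)
  have y4: "4 / y^4 = 4 * c * \<theta>\<^sup>2"
  proof -
    have "sqrt (2 * \<theta>) ^ 4 = (sqrt (2 * \<theta>) ^ 2) ^ 2" by (simp flip: power_mult)
    then have "sqrt (2 * \<theta>) ^ 4 = 4 * \<theta>\<^sup>2" using \<theta> by (simp add: power_mult_distrib)
    then show ?thesis unfolding y_def c_def using assms s_pos
      by (simp add: power_divide power_mult_distrib)
  qed
  \<comment> \<open>Since blocks have length at least \<open>\<theta> * n\<close>, an index up to
    \<open>\<kappa> * n\<close> lies in a block with number at most
    \<open>\<kappa> / \<theta>\<close>, hence below \<open>q\<close>.\<close>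
  define q where "q = nat \<lceil>\<kappa> / \<theta>\<rceil> + 1"
  have q: "real q \<le> \<kappa> / \<theta> + 2" "real q > \<kappa> / \<theta>"
    using assms \<theta> unfolding q_def by (simp_all add: of_nat_nat) linarith+
  have total: "real q * (2 * (4 / y^4)) \<le> \<eta>"
  proof -
    have "real q * (2 * (4 / y^4)) \<le> (\<kappa> / \<theta> + 2) * (2 * (4 / y^4))"
      using q y by (intro mult_right_mono) auto
    also have "\<dots> = 8 * c * (\<kappa> * \<theta> + 2 * \<theta> * \<theta>)"
      unfolding y4 using \<theta>(1) by (simp add: field_simps power2_eq_square)
    also have "\<dots> \<le> 8 * c * (\<kappa> * \<theta> + 2 * \<theta> * 1)"
      using \<theta> c by (intro mult_left_mono add_left_mono) auto
    also have "\<dots> = 8 * c * (\<kappa> + 2) * \<theta>" by (simp add: algebra_simps)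
    also have "\<dots> \<le> \<eta>" using \<theta>(3) c assms by (simp add: pos_le_divide_eq mult.commute)
    finally show ?thesis .
  qed
  have flim: "filterlim (\<lambda>n. nat \<lceil>\<theta> * real n\<rceil>) at_top sequentially"
    using \<theta>(1) by real_asymp
  have "eventually (\<lambda>n. prob {\<omega>\<in>space M. \<bar>W (nat \<lceil>\<theta> * real n\<rceil>) \<omega>\<bar> > y * s * sqrt (nat \<lceil>\<theta> * real n\<rceil>)} \<le> 4 / y^4) sequentially"
    using eventually_compose_filterlim[OF tail_W[OF y] flim] .
  moreover have "eventually (\<lambda>n. \<theta> * real n \<ge> 1) sequentially" using \<theta>(1) by real_asymp
  ultimately have "eventually (\<lambda>n. \<exists>A\<in>sets M. prob A \<le> \<eta> \<and>
    (\<forall>\<omega>\<in>space M - A. \<forall>j k. real j \<le> \<kappa> * n \<longrightarrow> real k \<le> \<kappa> * n \<longrightarrow> \<bar>real j - real k\<bar> \<le> \<theta> * n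
       \<longrightarrow> \<bar>W j \<omega> - W k \<omega>\<bar> \<le> \<epsilon> * sqrt n)) sequentially"
  proof eventually_elim
    case (elim n)
    define r where "r = nat \<lceil>\<theta> * real n\<rceil>"
    \<comment> \<open>Two nearby indices are joined by at most three moves, each starting or ending
      at the left end of a block and each of size at most \<open>2 * x\<close>; this gives
      \<open>6 * x = \<epsilon> * sqrt n\<close>.\<close>
    define x where "x = \<epsilon> * sqrt n / 6"
    have n0: "n > 0" using elim(2) by (cases n) auto
    have x: "x > 0" using assms n0 by (simp add: x_def)
    have r: "real r \<ge> \<theta> * n" "real r \<le> 2 * \<theta> * n"
      using elim(2) unfolding r_def by (simp_all add: of_nat_nat) linarith
    have r0: "r > 0" using r(1) elim(2) by (cases r) auto
    have x2: "x\<^sup>2 = \<epsilon>\<^sup>2 * n / 36" by (simp add: x_def power_divide power_mult_distrib)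
    have small: "r * s\<^sup>2 / x\<^sup>2 \<le> 1/2"
    proof -
      have "r * s\<^sup>2 \<le> 2 * \<theta> * n * s\<^sup>2" by (intro mult_right_mono r) auto
      also have "\<dots> = \<theta> * (2 * n * s\<^sup>2)" by simp
      also have "\<dots> \<le> \<epsilon>\<^sup>2 / (144 * s\<^sup>2) * (2 * n * s\<^sup>2)" by (intro mult_right_mono \<theta>) auto
      also have "\<dots> = x\<^sup>2 / 2" using s_pos unfolding x2 by (simp add: field_simps)
      finally show ?thesis using x by (simp add: field_simps)
    qed
    have yx: "y * s * sqrt r \<le> x"
    proof -
      have "sqrt r \<le> sqrt (2 * \<theta>) * sqrt n" using r(2) by (simp flip: real_sqrt_mult)
      then have "y * s * sqrt r \<le> y * s * (sqrt (2 * \<theta>) * sqrt n)"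
        using y s_pos by (intro mult_left_mono) auto
      also have "\<dots> = x" using s_pos \<theta> unfolding y_def x_def by simp
      finally show ?thesis .
    qed
    have tail: "prob {\<omega>\<in>space M. \<bar>W r \<omega>\<bar> > x} \<le> 4 / y^4"
    proof -
      have "prob {\<omega>\<in>space M. \<bar>W r \<omega>\<bar> > x} \<le> prob {\<omega>\<in>space M. \<bar>W r \<omega>\<bar> > y * s * sqrt r}"
        using yx by (intro finite_measure_mono) auto
      then show ?thesis using elim(1) by (simp add: r_def)
    qed
    define A where "A b = {\<omega>\<in>space M. \<exists>i\<le>r. \<bar>\<Sum>j\<in>{b*r..<b*r+i}. V j \<omega>\<bar> > 2 * x}" for b
    have [measurable]: "A b \<in> sets M" for b unfolding A_def by measurable
    have "prob (\<Union>b\<in>{..<q}. A b) \<le> (\<Sum>b\<in>{..<q}. prob (A b))"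
      by (intro finite_measure_subadditive_finite) auto
    also have "\<dots> \<le> (\<Sum>b\<in>{..<q}. 2 * (4 / y^4))"
    proof (rule sum_mono)
      fix b
      show "prob (A b) \<le> 2 * (4 / y^4)"
        using Ottaviani[OF x small, of "b*r"] tail unfolding A_def by linarith
    qed
    also have "\<dots> \<le> \<eta>" using total by simp
    finally have PA: "prob (\<Union>b\<in>{..<q}. A b) \<le> \<eta>" .
    have mod: "\<bar>W j \<omega> - W k \<omega>\<bar> \<le> 6 * x"
      if w: "\<omega> \<in> space M - (\<Union>b\<in>{..<q}. A b)" and jk: "j \<le> k" "real k \<le> \<kappa> * n" "real k - real j \<le> \<theta> * n" for \<omega> j k
    proof -
      have D: "\<bar>W (b*r+i) \<omega> - W (b*r) \<omega>\<bar> \<le> 2 * x" if "b < q" "i \<le> r" for b i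
        using w that unfolding A_def by (auto simp: W_diff not_less)
      have dq: "k' div r < q" if "k' \<le> k" for k'
      proof -
        have "real (k' div r) \<le> real k' / real r" using r0 div_times_less_eq_dividend[of k' r]
          by (simp add: pos_le_divide_eq flip: of_nat_mult)
        also have "\<dots> \<le> (\<kappa> * n) / (\<theta> * n)"
          using that jk r assms n0 \<theta> by (intro frac_le) auto
        also have "\<dots> = \<kappa> / \<theta>" using n0 by simp
        also have "\<dots> < q" by (rule q)
        finally show ?thesis by simp
      qed
      let ?b = "j div r" and ?b' = "k div r"
      have j: "\<bar>W j \<omega> - W (?b*r) \<omega>\<bar> \<le> 2 * x"
        using D[OF dq[of j], of "j mod r"] jk r0 by (simp add: less_imp_le)
      have k: "\<bar>W k \<omega> - W (?b'*r) \<omega>\<bar> \<le> 2 * x"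
        using D[OF dq[of k], of "k mod r"] jk r0 by (simp add: less_imp_le)
      \<comment> \<open>The distance of the indices is at most \<open>\<theta> * n \<le> r\<close>,
        so they lie in the same block or in adjacent ones.\<close>
      have "real k \<le> real (j + r)" using jk r by simp
      then have "k \<le> j + r" by (simp only: of_nat_le_iff)
      then have "?b' \<le> (j + r) div r" by (rule div_le_mono)
      then have "?b' \<le> ?b + 1" using r0 by simp
      moreover have "?b \<le> ?b'" using jk by (intro div_le_mono)
      ultimately consider "?b' = ?b" | "?b' = ?b + 1" by linarith
      then show ?thesis
      proof cases
        case 1
        then show ?thesis using j k x by simp
      next
        case 2
        have "\<bar>W (?b*r+r) \<omega> - W (?b*r) \<omega>\<bar> \<le> 2 * x"
          by (rule D[OF dq]) (use jk in auto)
        moreover have "?b' * r = ?b * r + r" using 2 by simp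
        ultimately show ?thesis using j k by simp
      qed
    qed
    show ?case
    proof (intro bexI[of _ "\<Union>b\<in>{..<q}. A b"] conjI PA ballI allI impI)
      fix \<omega> j k assume "\<omega> \<in> space M - (\<Union>b\<in>{..<q}. A b)" "real j \<le> \<kappa> * n" "real k \<le> \<kappa> * n" "\<bar>real j - real k\<bar> \<le> \<theta> * n"
      then show "\<bar>W j \<omega> - W k \<omega>\<bar> \<le> \<epsilon> * sqrt n"
        using mod[of \<omega> j k] mod[of \<omega> k j] by (cases "j \<le> k") (auto simp: x_def)
    qed auto
  qed
  with \<theta>(1) show ?thesis by (intro exI[of _ \<theta>] conjI)
qed

text \<open>The increments are sums over disjoint index blocks, hence independent, and the length
  \<open>r n\<close> of a block satisfies \<open>r n / n \<longlonglongrightarrow> a / m\<close>.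
  The central limit theorem along \<open>r n\<close>, rescaled by
  \<open>c * s * sqrt (r n / n)\<close>, therefore gives the normal law of variance
  \<open>c\<^sup>2 * s\<^sup>2 * a / m = 1 / m\<close>.\<close>

lemma W_increments_weak_limit:
  fixes a c :: real and m :: nat and E :: "nat \<Rightarrow> 'b \<Rightarrow> real" and G :: "(nat \<Rightarrow> real) \<Rightarrow> real"
  assumes a: "a > 0" and c: "c > 0" "c\<^sup>2 * s\<^sup>2 * a = 1" and m: "m > 0"
    and N: "prob_space N" and E: "prob_space.indep_vars N (\<lambda>_. borel) E {..<m}"
    and Ed: "\<And>i. i < m \<Longrightarrow> distributed N lborel (E i) (\<lambda>x. ennreal (normal_density 0 (sqrt (1 / m)) x))"
    and K: "\<And>x. \<bar>G x\<bar> \<le> K"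
    and cont: "\<And>x y. (\<And>i. i < m \<Longrightarrow> (\<lambda>n. x n i) \<longlonglongrightarrow> y i) \<Longrightarrow> (\<lambda>n. G (x n)) \<longlonglongrightarrow> G y"
  defines "\<tau> \<equiv> \<lambda>n i :: nat. nat \<lfloor>a * (n * (i / m))\<rfloor>"
  shows "(\<lambda>n. \<integral>\<omega>. G (\<lambda>i. c / sqrt n * (W (\<tau> n (Suc i)) \<omega> - W (\<tau> n i) \<omega>)) \<partial>M) \<longlonglongrightarrow> (\<integral>\<omega>. G (\<lambda>i. E i \<omega>) \<partial>N)"
proof (rule indep_vars_weak_limit[where I="{..<m}" and G=G and M=M and N=N and E=E and K=K
    and D="\<lambda>n i \<omega>. c / sqrt n * (W (\<tau> n (Suc i)) \<omega> - W (\<tau> n i) \<omega>)"])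
  have mono: "\<tau> n i \<le> \<tau> n j" if "i \<le> j" for n i j
    unfolding \<tau>_def using that a
    by (intro nat_mono floor_mono mult_left_mono divide_right_mono) auto
  show "indep_vars (\<lambda>_. borel) (\<lambda>i \<omega>. c / sqrt n * (W (\<tau> n (Suc i)) \<omega> - W (\<tau> n i) \<omega>)) {..<m}" for n
  proof -
    let ?K = "\<lambda>i::nat. {\<tau> n i..<\<tau> n (Suc i)}"
    have "disjoint_family_on ?K {..<m}"
      unfolding disjoint_family_on_def
    proof (intro ballI impI)
      fix i j :: nat assume "i \<noteq> j"
      then show "?K i \<inter> ?K j = {}"
        using mono[of "Suc i" j n] mono[of "Suc j" i n] by (cases "i < j") auto
    qed
    then have "indep_vars (\<lambda>i. PiM (?K i) (\<lambda>_. borel)) (\<lambda>i \<omega>. restrict (\<lambda>j. V j \<omega>) (?K i)) {..<m}"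
      by (intro indep_vars_restrict[OF indep]) auto
    then have "indep_vars (\<lambda>_. borel) (\<lambda>i \<omega>. c / sqrt n * (\<Sum>j\<in>?K i. restrict (\<lambda>j. V j \<omega>) (?K i) j)) {..<m}"
      by (rule indep_vars_compose2[where Y="\<lambda>i y. c / sqrt n * (\<Sum>j\<in>?K i. y j)"]) measurable
    also have "(\<lambda>i \<omega>. c / sqrt n * (\<Sum>j\<in>?K i. restrict (\<lambda>j. V j \<omega>) (?K i) j)) =
        (\<lambda>i \<omega>. c / sqrt n * (W (\<tau> n (Suc i)) \<omega> - W (\<tau> n i) \<omega>))"
      by (simp add: W_diff[OF mono])
    finally show ?thesis .
  qed
  show "weak_conv_m (\<lambda>n. distr M borel (\<lambda>\<omega>. c / sqrt n * (W (\<tau> n (Suc i)) \<omega> - W (\<tau> n i) \<omega>))) (distr N borel (E i))"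
    if "i \<in> {..<m}" for i
  proof -
    define r where "r n = \<tau> n (Suc i) - \<tau> n i" for n
    define \<mu> where "\<mu> r = distr M borel (\<lambda>\<omega>. W r \<omega> / sqrt (r * s\<^sup>2))" for r :: nat
    have r: "real (r n) = of_int (\<lfloor>a * (n * (Suc i / m))\<rfloor> - \<lfloor>a * (n * (i / m))\<rfloor>)" for n
    proof -
      have t: "real (\<tau> n j) = of_int \<lfloor>a * (n * (j / m))\<rfloor>" for j
        unfolding \<tau>_def using a by (intro of_nat_nat) simp
      have "real (r n) = real (\<tau> n (Suc i)) - real (\<tau> n i)"
        unfolding r_def using mono[of i "Suc i" n] by (intro of_nat_diff) simp
      then show ?thesis by (simp only: t of_int_diff)
    qed
    have lr: "(\<lambda>n. r n / n) \<longlonglongrightarrow> a / m"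
      unfolding r
    proof (rule real_tendsto_sandwich)
      have mi: "a * (n * (Suc i / m)) - a * (n * (i / m)) = a / m * n" for n :: nat
        using m by (simp add: field_simps)
      show "eventually (\<lambda>n. (a / m * n - 1) / n \<le> of_int (\<lfloor>a * (n * (Suc i / m))\<rfloor> - \<lfloor>a * (n * (i / m))\<rfloor>) / n) sequentially"
      proof (intro always_eventually allI divide_right_mono)
        fix n :: nat
        show "a / m * n - 1 \<le> real_of_int (\<lfloor>a * (n * (Suc i / m))\<rfloor> - \<lfloor>a * (n * (i / m))\<rfloor>)"
          using mi[of n] by linarith
      qed simp
      show "eventually (\<lambda>n. of_int (\<lfloor>a * (n * (Suc i / m))\<rfloor> - \<lfloor>a * (n * (i / m))\<rfloor>) / n \<le> (a / m * n + 1) / n) sequentially"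
      proof (intro always_eventually allI divide_right_mono)
        fix n :: nat
        show "real_of_int (\<lfloor>a * (n * (Suc i / m))\<rfloor> - \<lfloor>a * (n * (i / m))\<rfloor>) \<le> a / m * n + 1"
          using mi[of n] by linarith
      qed simp
      show "(\<lambda>n. (a / m * n - 1) / n) \<longlonglongrightarrow> a / m" "(\<lambda>n. (a / m * n + 1) / n) \<longlonglongrightarrow> a / m"
        by real_asymp+
    qed
    have rtop: "filterlim r at_top sequentially"
    proof -
      have "filterlim (\<lambda>n. r n / n * n) at_top sequentially"
        using a m by (intro filterlim_tendsto_pos_mult_at_top[OF lr] filterlim_real_sequentially) auto
      moreover have "eventually (\<lambda>n. r n / n * n = real (r n)) sequentially"
        using eventually_gt_at_top[of 0] by eventually_elim simp
      ultimately have "filterlim (\<lambda>n. real (r n)) at_top sequentially"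
        by (simp cong: filterlim_cong)
      then show ?thesis by (simp add: filterlim_sequentially_iff_filterlim_real)
    qed
    have "(\<lambda>n. c * s * sqrt (r n / n)) \<longlonglongrightarrow> c * s * sqrt (a / m)"
      by (intro tendsto_intros lr)
    also have "c * s * sqrt (a / m) = sqrt (1 / m)"
    proof -
      have "c * s * sqrt (a / m) = sqrt ((c * s)\<^sup>2) * sqrt (a / m)"
        using c(1) s_pos by simp
      also have "\<dots> = sqrt (c\<^sup>2 * s\<^sup>2 * a / m)"
        by (simp only: real_sqrt_mult[symmetric] power_mult_distrib times_divide_eq_right)
      finally show ?thesis by (simp only: c(2))
    qed
    finally have lc: "(\<lambda>n. c * s * sqrt (r n / n)) \<longlonglongrightarrow> sqrt (1 / m)" .
    have w: "weak_conv_m (\<lambda>n. \<mu> (r n)) std_normal_distribution"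
      using CLT rtop unfolding weak_conv_m_def weak_conv_def \<mu>_def
      by (auto intro: filterlim_compose)
    have rd: "real_distribution (\<mu> n)" for n
      unfolding \<mu>_def by (auto simp: real_distribution_def real_distribution_axioms_def intro!: prob_space_distr)
    have "weak_conv_m (\<lambda>n. distr (\<mu> (r n)) borel (\<lambda>x. c * s * sqrt (r n / n) * x))
       (distr std_normal_distribution borel (\<lambda>x. sqrt (1 / m) * x))"
      by (rule weak_conv_scaled[OF rd real_dist_normal_dist w lc])
    also have "(\<lambda>n. distr (\<mu> (r n)) borel (\<lambda>x. c * s * sqrt (r n / n) * x)) =
      (\<lambda>n. distr M borel (\<lambda>\<omega>. c / sqrt n * (W (\<tau> n (Suc i)) \<omega> - W (\<tau> n i) \<omega>)))"
    proof
      fix n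
      have e: "c * s * sqrt (r n / n) * (x / sqrt (r n * s\<^sup>2)) = c / sqrt n * x" if "r n > 0" for x
        using that s_pos by (simp add: real_sqrt_mult real_sqrt_divide)
      \<comment> \<open>For small \<open>n\<close> the block may be empty; both sides are then 0,
        the left one because \<open>sqrt 0 = 0\<close>.\<close>
      have e': "c * s * sqrt (r n / n) * (W (r n) \<omega> / sqrt (r n * s\<^sup>2)) = c / sqrt n * W (r n) \<omega>" for \<omega>
        by (cases "r n = 0") (simp add: W_def, rule e, simp)
      have "distr (\<mu> (r n)) borel (\<lambda>x. c * s * sqrt (r n / n) * x) =
        distr M borel (\<lambda>\<omega>. c / sqrt n * W (r n) \<omega>)"
        unfolding \<mu>_def by (subst distr_distr) (auto simp: comp_def e' simp del: times_divide_eq_right)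
      also have "\<dots> = distr (distr M borel (W (r n))) borel (\<lambda>x. c / sqrt n * x)"
        by (subst distr_distr) (auto simp: comp_def)
      also have "\<dots> = distr (distr M borel (\<lambda>\<omega>. \<Sum>j\<in>{\<tau> n i..<\<tau> n i + r n}. V j \<omega>)) borel (\<lambda>x. c / sqrt n * x)"
        by (simp only: block_distr)
      also have "(\<lambda>\<omega>. \<Sum>j\<in>{\<tau> n i..<\<tau> n i + r n}. V j \<omega>) = (\<lambda>\<omega>. W (\<tau> n (Suc i)) \<omega> - W (\<tau> n i) \<omega>)"
        using mono[of i "Suc i" n] by (simp add: W_diff r_def)
      also have "distr (distr M borel (\<lambda>\<omega>. W (\<tau> n (Suc i)) \<omega> - W (\<tau> n i) \<omega>)) borel (\<lambda>x. c / sqrt n * x) =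
         distr M borel (\<lambda>\<omega>. c / sqrt n * (W (\<tau> n (Suc i)) \<omega> - W (\<tau> n i) \<omega>))"
        by (subst distr_distr) (auto simp: comp_def)
      finally show "distr (\<mu> (r n)) borel (\<lambda>x. c * s * sqrt (r n / n) * x) =
        distr M borel (\<lambda>\<omega>. c / sqrt n * (W (\<tau> n (Suc i)) \<omega> - W (\<tau> n i) \<omega>))" .
    qed
    also have "distr std_normal_distribution borel (\<lambda>x. sqrt (1 / m) * x) = distr N borel (E i)"
    proof -
      interpret Z: prob_space std_normal_distribution
        by (rule real_distribution.axioms(1)[OF real_dist_normal_dist])
      have "distributed std_normal_distribution lborel (\<lambda>x. x) (\<lambda>x. ennreal (normal_density 0 1 x))"
        using distr_id2[of lborel std_normal_distribution] by (simp add: distributed_def)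
      from Z.normal_density_affine[OF this, of "sqrt (1 / m)" 0]
      have "distributed std_normal_distribution lborel (\<lambda>x. sqrt (1 / m) * x) (\<lambda>x. ennreal (normal_density 0 (sqrt (1 / m)) x))"
        using m by simp
      then have "distr std_normal_distribution lborel (\<lambda>x. sqrt (1 / m) * x) = distr N lborel (E i)"
        using Ed[of i] that by (simp add: distributed_def)
      moreover have "distr std_normal_distribution lborel (\<lambda>x. sqrt (1 / m) * x) =
          distr std_normal_distribution borel (\<lambda>x. sqrt (1 / m) * x)"
        by (rule distr_cong) auto
      moreover have "distr N lborel (E i) = distr N borel (E i)" by (rule distr_cong) auto
      ultimately show ?thesis by metis
    qed
    finally show ?thesis .
  qed
qed (use assms prob_space_axioms in auto)

end

subsection \<open>Functionals on continuous paths\<close>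

text \<open>Parametrised by the increments \<open>d\<close> because these are the independent
  quantities. The factor of \<open>d i\<close> is a ramp that climbs from 0 to 1 on
  \<open>[i/m, (i+1)/m]\<close>, so continuity in \<open>t\<close> and linearity in \<open>d\<close>
  need no case distinction on the position of \<open>t\<close>.\<close>

definition linear_path :: "nat \<Rightarrow> (nat \<Rightarrow> real) \<Rightarrow> real \<Rightarrow> real" where
  "linear_path m d t = (\<Sum>i<m. d i * max 0 (min 1 (real m * t - real i)))"

definition grid_increments :: "nat \<Rightarrow> (real \<Rightarrow> real) \<Rightarrow> nat \<Rightarrow> real" where
  "grid_increments m f i = f (real (Suc i) / real m) - f (real i / real m)"

lemma continuous_linear_path: "continuous_on A (linear_path m d)"
  unfolding linear_path_def
  by (intro continuous_on_sum continuous_on_mult continuous_on_max continuous_on_min continuous_on_diff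
      continuous_on_const continuous_on_id)

lemma linear_path_diff_le:
  "\<bar>linear_path m x t - linear_path m y t\<bar> \<le> (\<Sum>i<m. \<bar>x i - y i\<bar>)"
proof -
  have "\<bar>linear_path m x t - linear_path m y t\<bar> =
      \<bar>\<Sum>i<m. (x i - y i) * max 0 (min 1 (real m * t - real i))\<bar>"
    unfolding linear_path_def by (simp add: sum_subtractf left_diff_distrib)
  also have "\<dots> \<le> (\<Sum>i<m. \<bar>(x i - y i) * max 0 (min 1 (real m * t - real i))\<bar>)"
    by (rule sum_abs)
  also have "\<dots> \<le> (\<Sum>i<m. \<bar>x i - y i\<bar>)"
    by (intro sum_mono) (auto simp: abs_mult intro!: mult_left_le)
  finally show ?thesis .
qed

lemma linear_path_eq:
  assumes m: "m > 0" and t: "t \<in> {0..1}" and f0: "f 0 = 0"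
  obtains i where "i < m" "real i / m \<le> t" "t \<le> real (Suc i) / m"
    "linear_path m (grid_increments m f) t =
       f (real i / m) + (f (real (Suc i) / m) - f (real i / m)) * (m * t - i)"
proof -
  \<comment> \<open>The cap \<open>m - 1\<close> is for \<open>t = 1\<close>, where the floor is
    \<open>m\<close> and no cell begins.\<close>
  define i where "i = min (m - 1) (nat \<lfloor>m * t\<rfloor>)"
  have im: "i < m" using m by (simp add: i_def)
  have mt: "0 \<le> m * t" "m * t \<le> m" using t by (auto simp: mult_left_le)
  have lo: "real i \<le> m * t" using mt unfolding i_def by linarith
  have hi: "m * t \<le> real i + 1"
  proof (cases "nat \<lfloor>m * t\<rfloor> \<le> m - 1")
    case True
    then show ?thesis unfolding i_def using mt by linarith
  next
    case False
    then have "real i + 1 = m" using m by (simp add: i_def of_nat_diff)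
    then show ?thesis using mt by simp
  qed
  have S: "{..<m} = {..<i} \<union> ({i} \<union> {i<..<m})" using im by auto
  let ?h = "\<lambda>j. max 0 (min 1 (real m * t - real j))"
  let ?g = "grid_increments m f"
  have "linear_path m ?g t = (\<Sum>j<i. ?g j * ?h j) + (?g i * ?h i + (\<Sum>j\<in>{i<..<m}. ?g j * ?h j))"
    unfolding linear_path_def S by (subst sum.union_disjoint; (subst sum.union_disjoint)?; auto)
  also have "(\<Sum>j\<in>{i<..<m}. ?g j * ?h j) = 0"
    using hi by (intro sum.neutral) auto
  also have "(\<Sum>j<i. ?g j * ?h j) = (\<Sum>j<i. ?g j)"
  proof (rule sum.cong[OF refl])
    fix j assume "j \<in> {..<i}"
    then have "real j + 1 \<le> real i" by simp
    then have "?h j = 1" using lo by simp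
    then show "?g j * ?h j = ?g j" by simp
  qed
  also have "(\<Sum>j<i. ?g j) = f (real i / m)"
    unfolding grid_increments_def
    using sum_lessThan_telescope[of "\<lambda>j. f (real j / m)" i] f0 by simp
  also have "?h i = m * t - i" using lo hi by simp
  finally have "linear_path m ?g t = f (real i / m) + ?g i * (m * t - i)" by simp
  moreover have "real i / m \<le> t" "t \<le> real (Suc i) / m"
    using lo hi m by (simp_all add: divide_le_eq le_divide_eq mult.commute add.commute)
  ultimately show ?thesis using im that by (simp add: grid_increments_def)
qed

text \<open>The interpolated value is a convex combination of the values at the two neighbouring
  grid points, each within \<open>r\<close> of \<open>f t\<close>. Only the oscillation of
  \<open>f\<close> enters, so the lemma serves continuous paths and the rescaled walk, a step
  function, alike.\<close>

lemma linear_path_close: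
  assumes m: "m > 0" and f0: "f 0 = 0" and t: "t \<in> {0..1}"
    and osc: "\<And>u v. u \<in> {0..1} \<Longrightarrow> v \<in> {0..1} \<Longrightarrow> \<bar>u - v\<bar> \<le> 1 / m \<Longrightarrow> \<bar>f u - f v\<bar> \<le> r"
  shows "\<bar>linear_path m (grid_increments m f) t - f t\<bar> \<le> r"
proof -
  obtain i where i: "i < m" "real i / m \<le> t" "t \<le> real (Suc i) / m"
    and eq: "linear_path m (grid_increments m f) t =
       f (real i / m) + (f (real (Suc i) / m) - f (real i / m)) * (m * t - i)"
    by (rule linear_path_eq[where f=f, OF m t f0])
  define l where "l = m * t - i"
  have l: "0 \<le> l" "l \<le> 1" using i m by (auto simp: l_def field_simps)
  have w: "real (Suc i) / m = real i / m + 1 / m" by (simp add: add_divide_distrib)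
  have in01: "real i / m \<in> {0..1}" "real (Suc i) / m \<in> {0..1}" using i(1) by auto
  have 1: "\<bar>f (real i / m) - f t\<bar> \<le> r" using i(2,3) w by (intro osc in01 t) linarith
  have 2: "\<bar>f (real (Suc i) / m) - f t\<bar> \<le> r" using i(2,3) w by (intro osc in01 t) linarith
  have "linear_path m (grid_increments m f) t - f t = (1 - l) * (f (real i / m) - f t) + l * (f (real (Suc i) / m) - f t)"
    unfolding eq l_def[symmetric] by (simp add: algebra_simps)
  also have "\<bar>\<dots>\<bar> \<le> (1 - l) * r + l * r"
    using l mult_left_mono[OF 1, of "1 - l"] mult_left_mono[OF 2, of l]
    by (intro order_trans[OF abs_triangle_ineq] add_mono) (simp_all add: abs_mult)
  also have "\<dots> = r" by (simp add: algebra_simps)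
  finally show ?thesis .
qed

section \<open>Functionals along polygonal paths: limits and measurability\<close>

lemma bounded_cont_functional_seq:
  assumes F: "bounded_cont_functional F" and f: "continuous_on {0..1} f"
    and g: "\<And>n. continuous_on {0..1} (g n)"
    and conv: "\<And>e. e > 0 \<Longrightarrow> eventually (\<lambda>n. \<forall>t\<in>{0..1}. \<bar>g n t - f t\<bar> < e) sequentially"
  shows "(\<lambda>n. F (g n)) \<longlonglongrightarrow> F f"
proof (rule tendstoI)
  fix e :: real assume "e > 0"
  then obtain d where "d > 0" and
    d: "\<And>g. continuous_on {0..1} g \<Longrightarrow> (\<forall>t\<in>{0..1}. \<bar>f t - g t\<bar> < d) \<Longrightarrow> \<bar>F f - F g\<bar> < e"
    using F f unfolding bounded_cont_functional_def by metis
  show "eventually (\<lambda>n. dist (F (g n)) (F f) < e) sequentially"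
    using conv[OF \<open>d > 0\<close>]
  proof eventually_elim
    case (elim n)
    then have "\<bar>F f - F (g n)\<bar> < e" by (intro d g) (simp add: abs_minus_commute)
    then show ?case by (simp add: dist_real_def abs_minus_commute)
  qed
qed

lemma functional_linear_path_tendsto:
  assumes F: "bounded_cont_functional F" and x: "\<And>i. i < m \<Longrightarrow> (\<lambda>n. x n i) \<longlonglongrightarrow> y i"
  shows "(\<lambda>n. F (linear_path m (x n))) \<longlonglongrightarrow> F (linear_path m y)"
proof (rule bounded_cont_functional_seq[OF F])
  fix e :: real assume "e > 0"
  have "(\<lambda>n. \<Sum>i<m. \<bar>x n i - y i\<bar>) \<longlonglongrightarrow> (\<Sum>i<m. \<bar>y i - y i\<bar>)"
    by (intro tendsto_intros x) auto
  then have "eventually (\<lambda>n. (\<Sum>i<m. \<bar>x n i - y i\<bar>) < e) sequentially"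
    using \<open>e > 0\<close> by (intro order_tendstoD(2)[where a=e]) auto
  then show "eventually (\<lambda>n. \<forall>t\<in>{0..1}. \<bar>linear_path m (x n) t - linear_path m y t\<bar> < e) sequentially"
    by eventually_elim (blast intro: le_less_trans[OF linear_path_diff_le])
qed (rule continuous_linear_path)+

lemma linear_path_tendsto:
  assumes f: "continuous_on {0..1} f" "f 0 = 0" and "e > 0"
  shows "eventually (\<lambda>m. \<forall>t\<in>{0..1}. \<bar>linear_path m (grid_increments m f) t - f t\<bar> < e) sequentially"
proof -
  have "uniformly_continuous_on {0..1} f"
    by (rule compact_uniformly_continuous[OF f(1)]) simp
  then obtain d where "d > 0" and
    d: "\<And>u v. u \<in> {0..1} \<Longrightarrow> v \<in> {0..1} \<Longrightarrow> dist v u < d \<Longrightarrow> dist (f v) (f u) < e/2"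
    using \<open>e > 0\<close> unfolding uniformly_continuous_on_def by (metis half_gt_zero)
  have "eventually (\<lambda>m. 1 / real m < d) sequentially" using \<open>d > 0\<close> by real_asymp
  then show ?thesis using eventually_gt_at_top[of 0]
  proof eventually_elim
    case (elim m)
    show ?case
    proof
      fix t :: real assume t: "t \<in> {0..1}"
      have "\<bar>linear_path m (grid_increments m f) t - f t\<bar> \<le> e / 2"
      proof (rule linear_path_close[where f=f, OF elim(2) f(2) t])
        fix u v :: real assume uv: "u \<in> {0..1}" "v \<in> {0..1}" "\<bar>u - v\<bar> \<le> 1 / m"
        then show "\<bar>f u - f v\<bar> \<le> e / 2" using d[of v u] elim by (simp add: dist_real_def)
      qed
      then show "\<bar>linear_path m (grid_increments m f) t - f t\<bar> < e" using \<open>e > 0\<close> by linarith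
    qed
  qed
qed

text \<open>Path space carries no \<sigma>-algebra here. On polygonal paths \<open>F\<close> becomes
  a sequentially continuous function of \<open>m\<close> real numbers, and its measurability is that
  of such a function.\<close>

lemma measurable_functional_linear_path:
  assumes F: "bounded_cont_functional F" and [measurable]: "\<And>i. i < m \<Longrightarrow> (\<lambda>\<omega>. D \<omega> i) \<in> borel_measurable M"
  shows "(\<lambda>\<omega>. F (linear_path m (D \<omega>))) \<in> borel_measurable M"
proof -
  have G: "(\<lambda>d. F (linear_path m d)) \<in> borel_measurable (PiM {..<m} (\<lambda>_. borel))"
    by (rule borel_measurable_seq_continuous) (use functional_linear_path_tendsto[OF F] in auto)
  have "(\<lambda>\<omega>. \<lambda>i\<in>{..<m}. D \<omega> i) \<in> measurable M (PiM {..<m} (\<lambda>_. borel))"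
    by (intro measurable_restrict) auto
  from measurable_compose[OF this G]
  have "(\<lambda>\<omega>. F (linear_path m (\<lambda>i\<in>{..<m}. D \<omega> i))) \<in> borel_measurable M" .
  also have "(\<lambda>\<omega>. F (linear_path m (\<lambda>i\<in>{..<m}. D \<omega> i))) = (\<lambda>\<omega>. F (linear_path m (D \<omega>)))"
    unfolding linear_path_def by simp
  finally show ?thesis .
qed

text \<open>What the processes \<open>X\<^sub>n\<close> and the Brownian motion share; it is just
  enough to integrate continuous functionals of them.\<close>

definition C01_process :: "'a measure \<Rightarrow> ('a \<Rightarrow> real \<Rightarrow> real) \<Rightarrow> bool" where
  "C01_process M X \<longleftrightarrow> (\<forall>t\<in>{0..1}. (\<lambda>\<omega>. X \<omega> t) \<in> borel_measurable M) \<and>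
     (\<forall>\<omega>\<in>space M. X \<omega> 0 = 0 \<and> continuous_on {0..1} (X \<omega>))"

lemma functional_linear_path_limit:
  assumes "bounded_cont_functional F" "C01_process M X" "\<omega> \<in> space M"
  shows "(\<lambda>m. F (linear_path m (grid_increments m (X \<omega>)))) \<longlonglongrightarrow> F (X \<omega>)"
proof (rule bounded_cont_functional_seq[OF assms(1)])
  have X: "continuous_on {0..1} (X \<omega>)" "X \<omega> 0 = 0"
    using assms(2,3) by (auto simp: C01_process_def)
  show "continuous_on {0..1} (X \<omega>)" by (rule X)
  show "e > 0 \<Longrightarrow> eventually (\<lambda>m. \<forall>t\<in>{0..1}. \<bar>linear_path m (grid_increments m (X \<omega>)) t - X \<omega> t\<bar> < e) sequentially" for e
    by (rule linear_path_tendsto[OF X])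
qed (rule continuous_linear_path)

lemma measurable_functional_grid:
  assumes F: "bounded_cont_functional F" and X: "C01_process M X"
  shows "(\<lambda>\<omega>. F (linear_path m (grid_increments m (X \<omega>)))) \<in> borel_measurable M"
proof (rule measurable_functional_linear_path[OF F, where D="\<lambda>\<omega>. grid_increments m (X \<omega>)"])
  fix i assume "i < m"
  then have "real (Suc i) / real m \<in> {0..1}" "real i / real m \<in> {0..1}" by auto
  with X show "(\<lambda>\<omega>. grid_increments m (X \<omega>) i) \<in> borel_measurable M"
    unfolding C01_process_def grid_increments_def by (intro borel_measurable_diff) blast+
qed

text \<open>\<open>F (X \<omega>)\<close> is the pointwise limit of the measurable values of
  \<open>F\<close> on the polygonal interpolations of the path.\<close>

lemma measurable_functional:
  assumes F: "bounded_cont_functional F" and X: "C01_process M X"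
  shows "(\<lambda>\<omega>. F (X \<omega>)) \<in> borel_measurable M"
proof (rule borel_measurable_LIMSEQ_real)
  show "\<omega> \<in> space M \<Longrightarrow> (\<lambda>m. F (linear_path m (grid_increments m (X \<omega>)))) \<longlonglongrightarrow> F (X \<omega>)" for \<omega>
    by (rule functional_linear_path_limit[OF F X])
qed (rule measurable_functional_grid[OF F X])

section \<open>Reduction to Lipschitz functionals\<close>

definition lip_functional :: "((real \<Rightarrow> real) \<Rightarrow> real) \<Rightarrow> real \<Rightarrow> real \<Rightarrow> bool" where
  "lip_functional F K L \<longleftrightarrow> L \<ge> 0 \<and> (\<forall>f. continuous_on {0..1} f \<longrightarrow> \<bar>F f\<bar> \<le> K) \<and>
     (\<forall>f g r. continuous_on {0..1} f \<longrightarrow> continuous_on {0..1} g \<longrightarrow>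
        (\<forall>t\<in>{0..1}. \<bar>f t - g t\<bar> \<le> r) \<longrightarrow> \<bar>F f - F g\<bar> \<le> L * r)"

lemma lip_functional_bounded_cont:
  assumes "lip_functional F K L" shows "bounded_cont_functional F"
  unfolding bounded_cont_functional_def
proof (intro conjI allI impI)
  show "\<exists>K. \<forall>f. continuous_on {0..1} f \<longrightarrow> \<bar>F f\<bar> \<le> K" using assms by (auto simp: lip_functional_def)
next
  fix f :: "real \<Rightarrow> real" and e :: real assume f: "continuous_on {0..1} f" and e: "e > 0"
  have L: "L \<ge> 0" using assms by (simp add: lip_functional_def)
  show "\<exists>d>0. \<forall>g. continuous_on {0..1} g \<longrightarrow> (\<forall>t\<in>{0..1}. \<bar>f t - g t\<bar> < d) \<longrightarrow> \<bar>F f - F g\<bar> < e"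
  \<comment> \<open>\<open>L + 1\<close> instead of \<open>L\<close>, because \<open>L\<close> may
    be 0 and the final estimate has to be strict.\<close>
  proof (intro exI[of _ "e / (L + 1)"] conjI allI impI)
    fix g :: "real \<Rightarrow> real" assume g: "continuous_on {0..1} g" "\<forall>t\<in>{0..1}. \<bar>f t - g t\<bar> < e / (L + 1)"
    then have "\<bar>F f - F g\<bar> \<le> L * (e / (L + 1))"
      using assms f unfolding lip_functional_def by (meson less_imp_le)
    also have "\<dots> < e" using e L by (simp add: field_simps)
    finally show "\<bar>F f - F g\<bar> < e" .
  qed (use e L in simp)
qed

text \<open>The infimal convolution of \<open>F\<close> with \<open>k\<close> times the uniform distance: a \<open>k\<close>-Lipschitz minorant
  of \<open>F\<close> that increases to \<open>F\<close> by continuity alone.\<close>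

definition lip_approx :: "((real \<Rightarrow> real) \<Rightarrow> real) \<Rightarrow> nat \<Rightarrow> (real \<Rightarrow> real) \<Rightarrow> real" where
  "lip_approx F k f = (INF g\<in>{g. continuous_on {0..1} g}. F g + k * (SUP t\<in>{0..1}. \<bar>f t - g t\<bar>))"

lemma C01_diff_bdd:
  assumes "continuous_on {0..1} f" "continuous_on {0..1} (g :: real \<Rightarrow> real)"
  shows "bdd_above ((\<lambda>t. \<bar>f t - g t\<bar>) ` {0..1::real})"
proof -
  have "compact ((\<lambda>t. \<bar>f t - g t\<bar>) ` {0..1::real})"
    by (intro compact_continuous_image continuous_intros assms) simp
  then show ?thesis by (intro bounded_imp_bdd_above compact_imp_bounded)
qed

text \<open>The Lipschitz bound is the triangle inequality under the infimum. For the convergence, a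
  competitor \<open>g\<close> at distance at least \<open>d\<close> from \<open>f\<close> pays
  \<open>k * d \<ge> 2 * K\<close>, which exceeds any possible gain \<open>F f - F g\<close>, while
  a closer one has \<open>F g > F f - e/2\<close> by continuity of \<open>F\<close> at
  \<open>f\<close>.\<close>

lemma lip_approx:
  assumes F: "bounded_cont_functional F" and K': "\<forall>f. continuous_on {0..1} f \<longrightarrow> \<bar>F f\<bar> \<le> K"
  shows "lip_functional (lip_approx F k) K k"
    and "continuous_on {0..1} f \<Longrightarrow> lip_approx F k f \<le> F f"
    and "continuous_on {0..1} f \<Longrightarrow> (\<lambda>k. lip_approx F k f) \<longlonglongrightarrow> F f"
proof -
  have K: "\<bar>F f\<bar> \<le> K" if "continuous_on {0..1} f" for f using K' that by blast
  let ?C = "{g :: real \<Rightarrow> real. continuous_on {0..1} g}"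
  let ?d = "\<lambda>f g. SUP t\<in>{0..1::real}. \<bar>f t - g t :: real\<bar>"
  have ne: "?C \<noteq> {}" by (auto intro: continuous_on_const)
  have dge: "\<bar>f t - g t\<bar> \<le> ?d f g" if "f \<in> ?C" "g \<in> ?C" "t \<in> {0..1}" for f g t
    using that by (intro cSUP_upper C01_diff_bdd) auto
  have d0: "0 \<le> ?d f g" if "f \<in> ?C" "g \<in> ?C" for f g
    by (rule order_trans[OF abs_ge_zero dge[OF that, of 0]]) simp
  have dle: "?d f g \<le> r" if "\<And>t. t \<in> {0..1} \<Longrightarrow> \<bar>f t - g t\<bar> \<le> r" for f g r
    using that by (intro cSUP_least) auto
  have lower: "- K \<le> F g + real k * ?d f g" if "f \<in> ?C" "g \<in> ?C" for f g k
  proof -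
    have "0 \<le> real k * ?d f g" using d0[OF that] by simp
    moreover have "- K \<le> F g" using K[of g] that by (simp add: abs_le_iff)
    ultimately show ?thesis by linarith
  qed
  have bdd: "bdd_below ((\<lambda>g. F g + real k * ?d f g) ` ?C)" if "f \<in> ?C" for f k
    using lower[OF that] by (intro bdd_belowI2)
  have le: "lip_approx F k f \<le> F g + real k * ?d f g" if "f \<in> ?C" "g \<in> ?C" for f g k
    unfolding lip_approx_def using that by (intro cINF_lower bdd)
  have ge: "c \<le> lip_approx F k f" if "\<And>g. g \<in> ?C \<Longrightarrow> c \<le> F g + real k * ?d f g" for c f k
    unfolding lip_approx_def using that by (intro cINF_greatest ne)
  have dff: "?d f f = 0" for f by simp
  have leF: "lip_approx F k f \<le> F f" if "f \<in> ?C" for f k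
    using le[OF that that, of k] dff by simp
  have half: "lip_approx F k f \<le> lip_approx F k f' + real k * r"
    if f: "f \<in> ?C" "f' \<in> ?C" and r: "\<forall>t\<in>{0..1}. \<bar>f t - f' t\<bar> \<le> r" for f f' r k
  proof -
    have "lip_approx F k f - real k * r \<le> lip_approx F k f'"
    proof (rule ge)
      fix g assume g: "g \<in> ?C"
      have "?d f g \<le> r + ?d f' g"
      proof (rule dle)
        fix t :: real assume t: "t \<in> {0..1}"
        have "\<bar>f t - f' t\<bar> \<le> r" using r t by blast
        with dge[OF f(2) g t] show "\<bar>f t - g t\<bar> \<le> r + ?d f' g" by linarith
      qed
      then have "real k * ?d f g \<le> real k * r + real k * ?d f' g"
        by (metis distrib_left mult_left_mono of_nat_0_le_iff)
      with le[OF f(1) g, of k] show "lip_approx F k f - real k * r \<le> F g + real k * ?d f' g" by linarith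
    qed
    then show ?thesis by simp
  qed
  show "lip_functional (lip_approx F k) K k"
    unfolding lip_functional_def
  proof (intro conjI allI impI)
    fix f :: "real \<Rightarrow> real" assume f: "continuous_on {0..1} f"
    have "- K \<le> lip_approx F k f" using lower f by (intro ge) auto
    then show "\<bar>lip_approx F k f\<bar> \<le> K" using leF[of f k] K[OF f] f by simp
  next
    fix f g :: "real \<Rightarrow> real" and r assume "continuous_on {0..1} f" "continuous_on {0..1} g" "\<forall>t\<in>{0..1}. \<bar>f t - g t\<bar> \<le> r"
    then show "\<bar>lip_approx F k f - lip_approx F k g\<bar> \<le> real k * r"
      using half[of f g r k] half[of g f r k] by (simp add: abs_minus_commute)
  qed simp
  show "continuous_on {0..1} f \<Longrightarrow> lip_approx F k f \<le> F f" using leF by simp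
  assume f: "continuous_on {0..1} f"
  show "(\<lambda>k. lip_approx F k f) \<longlonglongrightarrow> F f"
  proof (rule tendstoI)
    fix e :: real assume "e > 0"
    then obtain d where "d > 0" and
      d: "\<And>g. continuous_on {0..1} g \<Longrightarrow> (\<forall>t\<in>{0..1}. \<bar>f t - g t\<bar> < d) \<Longrightarrow> \<bar>F f - F g\<bar> < e/2"
      using F f unfolding bounded_cont_functional_def by (metis half_gt_zero)
    have "eventually (\<lambda>k. real k * d \<ge> 2 * K) sequentially" using \<open>d > 0\<close> by real_asymp
    then show "eventually (\<lambda>k. dist (lip_approx F k f) (F f) < e) sequentially"
    proof eventually_elim
      case (elim k)
      have "F f - e/2 \<le> lip_approx F k f"
      proof (rule ge)
        fix g assume g: "g \<in> ?C"
        show "F f - e/2 \<le> F g + real k * ?d f g"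
        proof (cases "?d f g < d")
          case True
          then have "\<forall>t\<in>{0..1}. \<bar>f t - g t\<bar> < d" using le_less_trans[OF dge True] f g by simp
          then have "\<bar>F f - F g\<bar> < e/2" using d g by simp
          moreover have "0 \<le> real k * ?d f g" using d0[of f g] f g by simp
          ultimately show ?thesis by linarith
        next
          case False
          then have "real k * d \<le> real k * ?d f g" by (intro mult_left_mono) auto
          moreover have "F f \<le> K" "- K \<le> F g" using K[of f] K[of g] f g by (simp_all add: abs_le_iff)
          ultimately show ?thesis using elim \<open>e > 0\<close> by linarith
        qed
      qed
      then show ?case using leF[of f k] f \<open>e > 0\<close> by (simp add: dist_real_def)
    qed
  qed
qed

lemma integrable_functional:
  assumes "prob_space M" "bounded_cont_functional F" "C01_process M X"
  shows "integrable M (\<lambda>\<omega>. F (X \<omega>))"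
proof -
  interpret prob_space M by fact
  obtain K where "\<And>f. continuous_on {0..1} f \<Longrightarrow> \<bar>F f\<bar> \<le> K"
    using assms(2) unfolding bounded_cont_functional_def by blast
  with assms(3) show ?thesis
    by (intro integrable_const_bound[where B=K] measurable_functional assms AE_I2) (auto simp: C01_process_def)
qed

text \<open>A Lipschitz minorant whose integral under the limit is within \<open>e\<close> of that
  of \<open>F\<close> yields the lower bound for the integrals of \<open>F\<close>. Applied to
  \<open>- F\<close>, the same argument yields the upper bound.\<close>

lemma weak_conv_C01I:
  assumes M: "prob_space M" and N: "prob_space N" and X: "\<And>n. C01_process M (X n)" and B: "C01_process N B"
    and lip: "\<And>F K L. lip_functional F K L \<Longrightarrow>
      (\<lambda>n. \<integral>\<omega>. F (X n \<omega>) \<partial>M) \<longlonglongrightarrow> (\<integral>\<omega>. F (B \<omega>) \<partial>N)"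
  shows "weak_conv_C01 M X N B"
  unfolding weak_conv_C01_def
proof (intro allI impI)
  interpret N: prob_space N by fact
  have lower: "eventually (\<lambda>n. (\<integral>\<omega>. F (X n \<omega>) \<partial>M) > (\<integral>\<omega>. F (B \<omega>) \<partial>N) - e) sequentially"
    if F: "bounded_cont_functional F" and e: "e > 0" for F e
  proof -
    obtain K where K: "\<forall>f. continuous_on {0..1} f \<longrightarrow> \<bar>F f\<bar> \<le> K"
      using F unfolding bounded_cont_functional_def by blast
    note la = lip_approx[OF F K]
    have bc: "bounded_cont_functional (lip_approx F k)" for k
      by (rule lip_functional_bounded_cont[OF la(1)])
    have "(\<lambda>k. \<integral>\<omega>. lip_approx F k (B \<omega>) \<partial>N) \<longlonglongrightarrow> (\<integral>\<omega>. F (B \<omega>) \<partial>N)"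
    proof (rule integral_dominated_convergence[where w="\<lambda>_. K"])
      show "AE \<omega> in N. norm (lip_approx F k (B \<omega>)) \<le> K" for k
        using la(1)[of k] B by (intro AE_I2) (auto simp: lip_functional_def C01_process_def)
      show "AE \<omega> in N. (\<lambda>k. lip_approx F k (B \<omega>)) \<longlonglongrightarrow> F (B \<omega>)"
        using la(3) B by (intro AE_I2) (auto simp: C01_process_def)
    qed (auto intro: measurable_functional[OF F B] measurable_functional[OF bc B])
    then have "eventually (\<lambda>k. (\<integral>\<omega>. lip_approx F k (B \<omega>) \<partial>N) > (\<integral>\<omega>. F (B \<omega>) \<partial>N) - e) sequentially"
      using e by (intro order_tendstoD(1)) auto
    then obtain k where k: "(\<integral>\<omega>. lip_approx F k (B \<omega>) \<partial>N) > (\<integral>\<omega>. F (B \<omega>) \<partial>N) - e"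
      using eventually_happens'[OF sequentially_bot] by blast
    from order_tendstoD(1)[OF lip[OF la(1)] k]
    show ?thesis
    proof eventually_elim
      case (elim n)
      have "(\<integral>\<omega>. lip_approx F k (X n \<omega>) \<partial>M) \<le> (\<integral>\<omega>. F (X n \<omega>) \<partial>M)"
        using X[of n] la(2)
        by (intro integral_mono integrable_functional[OF M _ X] F bc) (auto simp: C01_process_def)
      with elim show ?case by linarith
    qed
  qed
  fix F assume F: "bounded_cont_functional F"
  then have F': "bounded_cont_functional (\<lambda>f. - F f)"
    unfolding bounded_cont_functional_def by (simp add: abs_minus_commute)
  show "(\<lambda>n. \<integral>\<omega>. F (X n \<omega>) \<partial>M) \<longlonglongrightarrow> (\<integral>\<omega>. F (B \<omega>) \<partial>N)"
  proof (rule tendstoI)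
    fix e :: real assume e: "e > 0"
    show "eventually (\<lambda>n. dist (\<integral>\<omega>. F (X n \<omega>) \<partial>M) (\<integral>\<omega>. F (B \<omega>) \<partial>N) < e) sequentially"
      using lower[OF F e] lower[OF F' e]
    proof eventually_elim
      case (elim n)
      then show ?case unfolding dist_real_def Bochner_Integration.integral_minus by linarith
    qed
  qed
qed

subsection \<open>Paths of the telegraph process\<close>

definition telegraph_Y :: "(nat \<Rightarrow> 'a \<Rightarrow> real) \<Rightarrow> 'a \<Rightarrow> real \<Rightarrow> real" where
  "telegraph_Y U \<omega> T = integral {0..T} (\<lambda>v. (-1::real) ^ renewal_L U v \<omega>)"

lemma renewal_L_measurable [measurable]: "(\<lambda>v. renewal_L U v \<omega>) \<in> measurable borel (count_space UNIV)"
  unfolding renewal_L_def by measurable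

lemma sign_set_integrable:
  fixes a b :: real
  assumes [measurable]: "(f :: real \<Rightarrow> nat) \<in> measurable borel (count_space UNIV)"
  shows "set_integrable lborel {a..b} (\<lambda>v. (-1::real) ^ f v)"
proof -
  have m: "(\<lambda>v. (-1::real) ^ f v) \<in> borel_measurable lborel" by measurable
  show ?thesis unfolding set_integrable_def
    by (rule integrableI_bounded_set_indicator[where B=1])
      (auto intro: m emeasure_lborel_box_finite simp: norm_power emeasure_lborel_Icc_eq)
qed

lemma sign_integrable: "(\<lambda>v. (-1::real) ^ renewal_L U v \<omega>) integrable_on {a..b}"
  by (rule set_borel_integral_eq_integral(1)[OF sign_set_integrable]) measurable

lemma telegraph_Y_Lipschitz:
  assumes "0 \<le> a" "a \<le> b"
  shows "\<bar>telegraph_Y U \<omega> b - telegraph_Y U \<omega> a\<bar> \<le> b - a"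
proof -
  let ?f = "\<lambda>v. (-1::real) ^ renewal_L U v \<omega>"
  have "telegraph_Y U \<omega> b - telegraph_Y U \<omega> a = integral {a..b} ?f"
    unfolding telegraph_Y_def using Henstock_Kurzweil_Integration.integral_combine[OF assms sign_integrable[of U \<omega>]] by linarith
  also have "norm \<dots> \<le> integral {a..b} (\<lambda>_. 1::real)"
    by (rule integral_norm_bound_integral) (auto intro: sign_integrable simp: norm_power)
  finally show ?thesis using assms by simp
qed

lemma telegraph_X_eq:
  assumes n: "n > 0" and t: "t \<ge> 0"
  shows "telegraph_X U C n \<omega> t = C / sqrt n * telegraph_Y U \<omega> (n * t)"
proof -
  let ?f = "\<lambda>v. (-1::real) ^ renewal_L U v \<omega>"
  have "(?f has_integral telegraph_Y U \<omega> (n * t)) {0..n * t}"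
    unfolding telegraph_Y_def by (rule integrable_integral[OF sign_integrable])
  from has_integral_stretch_real[OF this, of "real n"] n
  have "((\<lambda>x. ?f (n * x)) has_integral telegraph_Y U \<omega> (n * t) / n) ((\<lambda>x. x / real n) ` {0..n * t})"
    by simp
  moreover have "(\<lambda>x. x / real n) ` {0..n * t} = {0..t}"
    using n t by (simp add: image_divide_atLeastAtMost)
  ultimately have "integral {0..t} (\<lambda>x. ?f (n * x)) = telegraph_Y U \<omega> (n * t) / n"
    by (simp add: integral_unique)
  then have "telegraph_X U C n \<omega> t = C * (sqrt n / n) * telegraph_Y U \<omega> (n * t)"
    unfolding telegraph_X_def by simp
  also have "sqrt n / n = 1 / sqrt n" using n by (simp add: field_simps)
  finally show ?thesis by simp
qed

lemma telegraph_X_process: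
  assumes [measurable]: "\<And>k. k \<ge> 1 \<Longrightarrow> U k \<in> borel_measurable M"
  shows "C01_process M (telegraph_X U C n)"
  unfolding C01_process_def
proof (intro conjI ballI)
  fix \<omega>
  have i: "(\<lambda>u. (-1::real) ^ renewal_L U (real n * u) \<omega>) integrable_on {0..1}"
    by (rule set_borel_integral_eq_integral(1)[OF sign_set_integrable]) measurable
  show "telegraph_X U C n \<omega> 0 = 0" by (simp add: telegraph_X_def)
  show "continuous_on {0..1} (telegraph_X U C n \<omega>)"
    unfolding telegraph_X_def[abs_def]
    by (intro continuous_on_mult_left indefinite_integral_continuous_1 i)
next
  fix t :: real
  have S[measurable]: "renewal_S U k \<in> borel_measurable M" for k
    unfolding renewal_S_def[abs_def] by (intro borel_measurable_sum assms) auto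
  have S'[measurable]: "(\<lambda>x. renewal_S U k (fst x)) \<in> borel_measurable (M \<Otimes>\<^sub>M lborel)" for k
    by (rule measurable_compose[OF measurable_fst S])
  have [measurable]: "(\<lambda>x. renewal_L U (real n * snd x) (fst x)) \<in> measurable (M \<Otimes>\<^sub>M lborel) (count_space UNIV)"
    unfolding renewal_L_def by measurable
  \<comment> \<open>Measurability in \<omega> comes from joint measurability in
    \<open>(\<omega>, u)\<close> and the theorem on parametrised Lebesgue integrals, so the gauge
    integral is rewritten as a Lebesgue integral.\<close>
  have "telegraph_X U C n \<omega> t =
      C * sqrt n * (\<integral>u. indicator {0..t} u * (-1::real) ^ renewal_L U (real n * u) \<omega> \<partial>lborel)" for \<omega>
  proof -
    have "set_integrable lborel {0..t} (\<lambda>u. (-1::real) ^ renewal_L U (real n * u) \<omega>)"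
      by (rule sign_set_integrable) measurable
    from set_borel_integral_eq_integral(2)[OF this] show ?thesis
      unfolding telegraph_X_def set_lebesgue_integral_def by simp
  qed
  then have e: "(\<lambda>\<omega>. telegraph_X U C n \<omega> t) =
      (\<lambda>\<omega>. C * sqrt n * (\<integral>u. indicator {0..t} u * (-1::real) ^ renewal_L U (real n * u) \<omega> \<partial>lborel))" by blast
  have [measurable]: "(\<lambda>x. indicator {0..t} (snd x) * (-1::real) ^ renewal_L U (real n * snd x) (fst x))
     \<in> borel_measurable (M \<Otimes>\<^sub>M lborel)" by measurable
  show "(\<lambda>\<omega>. telegraph_X U C n \<omega> t) \<in> borel_measurable M"
    unfolding e
    by (intro borel_measurable_times borel_measurable_const lborel.borel_measurable_lebesgue_integral)
       (simp add: case_prod_beta)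
qed

section \<open>Pathwise comparison of the process with the walk\<close>

definition pair_walk :: "(nat \<Rightarrow> 'a \<Rightarrow> real) \<Rightarrow> nat \<Rightarrow> 'a \<Rightarrow> real" where
  "pair_walk U k \<omega> = (\<Sum>j<k. U (2*j+1) \<omega> - U (2*j+2) \<omega>)"

lemma renewal_S_Suc: "renewal_S U (Suc k) \<omega> = renewal_S U k \<omega> + U (Suc k) \<omega>"
  unfolding renewal_S_def by simp

context
  fixes U :: "nat \<Rightarrow> 'a \<Rightarrow> real" and \<omega> :: 'a
  assumes nonneg: "\<And>k. k \<ge> 1 \<Longrightarrow> U k \<omega> \<ge> 0"
begin

lemma renewal_S_mono: "i \<le> j \<Longrightarrow> renewal_S U i \<omega> \<le> renewal_S U j \<omega>"
  by (rule lift_Suc_mono_le[of "\<lambda>k. renewal_S U k \<omega>"]) (auto simp: renewal_S_Suc nonneg)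

lemma renewal_S_nonneg: "0 \<le> renewal_S U i \<omega>"
  unfolding renewal_S_def by (intro sum_nonneg nonneg) auto

lemma renewal_L_eq:
  assumes "renewal_S U k \<omega> \<le> v" "v < renewal_S U (Suc k) \<omega>"
  shows "renewal_L U v \<omega> = k"
proof -
  have "{n. 1 \<le> n \<and> 0 \<le> renewal_S U n \<omega> \<and> renewal_S U n \<omega> \<le> v} = {1..k}"
  proof (intro set_eqI iffI)
    fix n assume "n \<in> {n. 1 \<le> n \<and> 0 \<le> renewal_S U n \<omega> \<and> renewal_S U n \<omega> \<le> v}"
    then have n: "1 \<le> n" "renewal_S U n \<omega> \<le> v" by simp_all
    with assms have "\<not> Suc k \<le> n" using renewal_S_mono[of "Suc k" n] by linarith
    with n show "n \<in> {1..k}" by simp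
  next
    fix n assume n: "n \<in> {1..k}"
    with assms have "renewal_S U n \<omega> \<le> v" using renewal_S_mono[of n k] by simp
    with n show "n \<in> {n. 1 \<le> n \<and> 0 \<le> renewal_S U n \<omega> \<and> renewal_S U n \<omega> \<le> v}"
      by (simp add: renewal_S_nonneg)
  qed
  then show ?thesis by (simp add: renewal_L_def)
qed

text \<open>Between the two epochs the renewal process equals \<open>k\<close>, except possibly at
  the right end point, a single point that does not affect the integral. If
  \<open>U (Suc k) \<omega> = 0\<close> the interval is that point alone.\<close>

lemma telegraph_Y_step:
  "telegraph_Y U \<omega> (renewal_S U (Suc k) \<omega>) = telegraph_Y U \<omega> (renewal_S U k \<omega>) + (-1) ^ k * U (Suc k) \<omega>"
proof -
  let ?f = "\<lambda>v. (-1::real) ^ renewal_L U v \<omega>" and ?S = "\<lambda>k. renewal_S U k \<omega>"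
  have le: "?S k \<le> ?S (Suc k)" by (intro renewal_S_mono) simp
  have "((\<lambda>_. (-1::real)^k) has_integral ((?S (Suc k) - ?S k) * (-1)^k)) {?S k..?S (Suc k)}"
    using has_integral_const_real[of "(-1::real)^k" "?S k" "?S (Suc k)"] le by simp
  then have "(?f has_integral ((?S (Suc k) - ?S k) * (-1)^k)) {?S k..?S (Suc k)}"
    by (rule has_integral_spike_finite[of "{?S (Suc k)}", rotated 2]) (auto simp: renewal_L_eq)
  then have "integral {?S k..?S (Suc k)} ?f = (-1) ^ k * U (Suc k) \<omega>"
    by (simp add: integral_unique renewal_S_Suc)
  then show ?thesis
    unfolding telegraph_Y_def
    using Henstock_Kurzweil_Integration.integral_combine[OF renewal_S_nonneg le sign_integrable[of U \<omega>]] by linarith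
qed

lemma telegraph_Y_pair: "telegraph_Y U \<omega> (renewal_S U (2 * k) \<omega>) = pair_walk U k \<omega>"
proof (induction k)
  case 0
  then show ?case by (simp add: telegraph_Y_def pair_walk_def renewal_S_def)
next
  case (Suc k)
  have "telegraph_Y U \<omega> (renewal_S U (2 * Suc k) \<omega>) =
      telegraph_Y U \<omega> (renewal_S U (Suc (Suc (2 * k))) \<omega>)" by simp
  also have "\<dots> = pair_walk U k \<omega> + U (2*k+1) \<omega> - U (2*k+2) \<omega>"
    by (simp only: telegraph_Y_step Suc) simp
  finally show ?case by (simp add: pair_walk_def)
qed

text \<open>With \<open>v\<close> between the even epochs \<open>k\<close> and \<open>k + 1\<close>,
  \<open>Y(v)\<close> differs from the walk at \<open>k\<close> by at most the length of this pair.
  The law of large numbers puts \<open>k\<close> within \<open>\<theta> * n\<close> of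
  \<open>v / (2 * \<mu>)\<close>, and the modulus of the walk pays for that shift. Each of the two
  errors is at most \<open>\<epsilon> * sqrt n\<close>.\<close>

lemma telegraph_Y_time_change:
  fixes \<mu> \<theta> \<epsilon> \<delta> \<kappa> v :: real and n K :: nat
  assumes \<mu>: "\<mu> > 0" and K: "K > 0" "K \<le> \<kappa> * n" "2 * \<mu> * K - \<delta> * n \<ge> n"
    and lln: "\<And>k. k \<le> K \<Longrightarrow> \<bar>renewal_S U (2 * k) \<omega> - 2 * \<mu> * k\<bar> \<le> \<delta> * n"
    and small: "\<And>i. 1 \<le> i \<Longrightarrow> i \<le> 2 * K \<Longrightarrow> U i \<omega> \<le> \<epsilon> * sqrt n / 2"
    and mod: "\<And>j k. real j \<le> \<kappa> * n \<Longrightarrow> real k \<le> \<kappa> * n \<Longrightarrow> \<bar>real j - real k\<bar> \<le> \<theta> * n \<Longrightarrow>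
       \<bar>pair_walk U j \<omega> - pair_walk U k \<omega>\<bar> \<le> \<epsilon> * sqrt n"
    and \<theta>: "\<delta> * n + \<epsilon> * sqrt n + 2 * \<mu> \<le> 2 * \<mu> * \<theta> * n"
    and \<kappa>: "1 / (2 * \<mu>) \<le> \<kappa>"
    and v: "0 \<le> v" "v \<le> n"
  shows "\<bar>telegraph_Y U \<omega> v - pair_walk U (nat \<lfloor>v / (2 * \<mu>)\<rfloor>) \<omega>\<bar> \<le> 2 * \<epsilon> * sqrt n"
proof -
  let ?T = "\<lambda>k. renewal_S U (2 * k) \<omega>"
  have TK: "v \<le> ?T K" using lln[of K] K(3) v by linarith
  \<comment> \<open>\<open>v = 0\<close> is separate because there the least \<open>j\<close> with
    \<open>v \<le> ?T j\<close> is 0 and has no predecessor.\<close>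
  obtain k where k: "k < K" "?T k \<le> v" "v \<le> ?T (Suc k)"
  proof (cases "v = 0")
    case True
    have "?T 0 \<le> v" using True by (simp add: renewal_S_def)
    moreover have "v \<le> ?T (Suc 0)" using True renewal_S_nonneg by simp
    ultimately show ?thesis using K that by blast
  next
    case False
    define j where "j = (LEAST j. v \<le> ?T j)"
    have j: "v \<le> ?T j" "j \<le> K" unfolding j_def using TK by (auto intro: LeastI Least_le)
    have "j \<noteq> 0"
    proof
      assume "j = 0"
      then show False using j(1) False v by (simp add: renewal_S_def)
    qed
    then obtain k where jk: "j = Suc k" by (cases j) auto
    have "\<not> v \<le> ?T k" using not_less_Least[of k "\<lambda>j. v \<le> ?T j"] jk by (simp add: j_def)
    then show ?thesis using that[of k] j jk by simp
  qed
  have R: "?T (Suc k) - ?T k \<le> \<epsilon> * sqrt n"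
    using small[of "2*k+1"] small[of "2*k+2"] k(1) by (simp add: renewal_S_Suc)
  let ?j = "nat \<lfloor>v / (2 * \<mu>)\<rfloor>"
  have vm: "0 \<le> v / (2 * \<mu>)" using v \<mu> by simp
  have j1: "real ?j \<le> v / (2 * \<mu>)" "v / (2 * \<mu>) \<le> real ?j + 1" using vm by linarith+
  then have j2: "2 * \<mu> * real ?j \<le> v" "v \<le> 2 * \<mu> * real ?j + 2 * \<mu>"
    using \<mu> by (simp_all add: pos_le_divide_eq pos_divide_le_eq algebra_simps)
  have "\<bar>telegraph_Y U \<omega> v - pair_walk U k \<omega>\<bar> \<le> v - ?T k"
    using telegraph_Y_Lipschitz[OF renewal_S_nonneg k(2), of U \<omega>] by (simp add: telegraph_Y_pair)
  also have "\<dots> \<le> \<epsilon> * sqrt n" using R k by linarith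
  finally have 1: "\<bar>telegraph_Y U \<omega> v - pair_walk U k \<omega>\<bar> \<le> \<epsilon> * sqrt n" .
  \<comment> \<open>Three errors add up to the left side of the hypothesis on \<theta>:
    \<open>\<delta> * n\<close> from \<open>2 * \<mu> * k\<close> to \<open>?T k\<close>,
    \<open>\<epsilon> * sqrt n\<close> from there to \<open>v\<close>, and \<open>2 * \<mu>\<close>
    from rounding \<open>v / (2 * \<mu>)\<close> down.\<close>
  have d: "\<bar>2 * \<mu> * real k - 2 * \<mu> * real ?j\<bar> \<le> 2 * \<mu> * \<theta> * n"
    using lln[of k] k j2 R \<theta> by linarith
  have "\<bar>real k - real ?j\<bar> \<le> \<theta> * n"
  proof -
    have "2 * \<mu> * \<bar>real k - real ?j\<bar> \<le> 2 * \<mu> * (\<theta> * n)"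
      using d \<mu> by (simp add: abs_mult right_diff_distrib[symmetric])
    then show ?thesis using \<mu> by simp
  qed
  moreover have "real k \<le> \<kappa> * n" using k(1) K(2) by linarith
  moreover have "real ?j \<le> \<kappa> * n"
  proof -
    have "v / (2 * \<mu>) \<le> n * (1 / (2 * \<mu>))" using v \<mu> by (simp add: divide_right_mono)
    also have "\<dots> \<le> n * \<kappa>" by (intro mult_left_mono \<kappa>) simp
    finally show ?thesis using j1 by (simp add: mult.commute)
  qed
  ultimately have "\<bar>pair_walk U k \<omega> - pair_walk U ?j \<omega>\<bar> \<le> \<epsilon> * sqrt n" by (intro mod)
  with 1 show ?thesis by linarith
qed

text \<open>Of the \<open>3 * C * \<epsilon>\<close>, two parts come from the time change and one
  from the interpolation. For the latter, a cell of length \<open>1/m\<close> spans at most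
  \<open>1 / (2 * \<mu>) * (n / m) + 1\<close> steps of the walk, the 1 being due to the floors, and
  this has to stay within the range \<open>\<theta> * n\<close> of the modulus.\<close>

lemma telegraph_X_linear_path_close:
  fixes \<mu> \<theta> \<epsilon> \<delta> \<kappa> C :: real and n K m :: nat
  assumes \<mu>: "\<mu> > 0" and K: "K > 0" "K \<le> \<kappa> * n" "2 * \<mu> * K - \<delta> * n \<ge> n"
    and lln: "\<And>k. k \<le> K \<Longrightarrow> \<bar>renewal_S U (2 * k) \<omega> - 2 * \<mu> * k\<bar> \<le> \<delta> * n"
    and small: "\<And>i. 1 \<le> i \<Longrightarrow> i \<le> 2 * K \<Longrightarrow> U i \<omega> \<le> \<epsilon> * sqrt n / 2"
    and mod: "\<And>j k. real j \<le> \<kappa> * n \<Longrightarrow> real k \<le> \<kappa> * n \<Longrightarrow> \<bar>real j - real k\<bar> \<le> \<theta> * n \<Longrightarrow>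
       \<bar>pair_walk U j \<omega> - pair_walk U k \<omega>\<bar> \<le> \<epsilon> * sqrt n"
    and \<theta>: "\<delta> * n + \<epsilon> * sqrt n + 2 * \<mu> \<le> 2 * \<mu> * \<theta> * n"
    and \<kappa>: "1 / (2 * \<mu>) \<le> \<kappa>"
    and n: "n > 0" and C: "C > 0" and m: "m > 0" "1 / (2 * \<mu>) * (n / m) + 1 \<le> \<theta> * n"
    and t: "t \<in> {0..1}"
  defines "Z \<equiv> \<lambda>t::real. C / sqrt n * pair_walk U (nat \<lfloor>1 / (2 * \<mu>) * (n * t)\<rfloor>) \<omega>"
  shows "\<bar>telegraph_X U C n \<omega> t - linear_path m (grid_increments m Z) t\<bar> \<le> 3 * C * \<epsilon>"
proof -
  have c: "C / sqrt n > 0" using C n by simp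
  have cn: "C / sqrt n * (x * sqrt n) = C * x" for x using n by simp
  have XZ: "\<bar>telegraph_X U C n \<omega> t - Z t\<bar> \<le> 2 * C * \<epsilon>"
  proof -
    have "0 \<le> n * t" "n * t \<le> n" using t by (auto simp: mult_left_le)
    from telegraph_Y_time_change[OF \<mu> K lln small mod \<theta> \<kappa> this]
    have "\<bar>telegraph_Y U \<omega> (n * t) - pair_walk U (nat \<lfloor>1 / (2 * \<mu>) * (n * t)\<rfloor>) \<omega>\<bar> \<le> 2 * \<epsilon> * sqrt n"
      by simp
    then have "C / sqrt n * \<bar>telegraph_Y U \<omega> (n * t) - pair_walk U (nat \<lfloor>1 / (2 * \<mu>) * (n * t)\<rfloor>) \<omega>\<bar>
        \<le> C / sqrt n * (2 * \<epsilon> * sqrt n)" using c by (intro mult_left_mono) auto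
    moreover have "\<bar>telegraph_X U C n \<omega> t - Z t\<bar> =
       C / sqrt n * \<bar>telegraph_Y U \<omega> (n * t) - pair_walk U (nat \<lfloor>1 / (2 * \<mu>) * (n * t)\<rfloor>) \<omega>\<bar>"
      using t c unfolding Z_def by (simp only: telegraph_X_eq[OF n] atLeastAtMost_iff right_diff_distrib[symmetric] abs_mult abs_of_pos)
    ultimately show ?thesis unfolding cn by simp
  qed
  have "\<bar>linear_path m (grid_increments m Z) t - Z t\<bar> \<le> C * \<epsilon>"
  proof (rule linear_path_close[where f=Z, OF m(1) _ t])
    show "Z 0 = 0" by (simp add: Z_def pair_walk_def)
    fix x y :: real assume xy: "x \<in> {0..1}" "y \<in> {0..1}" "\<bar>x - y\<bar> \<le> 1 / m"
    let ?a = "\<lambda>x::real. 1 / (2 * \<mu>) * (n * x)"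
    let ?k = "\<lambda>x::real. nat \<lfloor>?a x\<rfloor>"
    have a0: "0 \<le> ?a x" "?a x \<le> \<kappa> * n" if "x \<in> {0..1}" for x :: real
    proof -
      show "0 \<le> ?a x" using that \<mu> by simp
      have "0 \<le> \<kappa>" by (rule order_trans[OF _ \<kappa>]) (use \<mu> in simp)
      then show "?a x \<le> \<kappa> * n" using that \<mu> \<kappa> by (intro mult_mono) (auto simp: mult_left_le)
    qed
    have k: "real (?k x) \<le> ?a x" "?a x \<le> real (?k x) + 1" if "x \<in> {0..1}" for x :: real
      using a0[OF that] by linarith+
    have "\<bar>?a x - ?a y\<bar> = 1 / (2 * \<mu>) * (n * \<bar>x - y\<bar>)"
      using \<mu> by (simp add: abs_mult flip: right_diff_distrib diff_divide_distrib)
    also have "\<dots> \<le> 1 / (2 * \<mu>) * (n * (1 / m))"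
      using \<mu> xy by (intro mult_left_mono) auto
    also have "n * (1 / m) = n / m" by simp
    finally have "\<bar>real (?k x) - real (?k y)\<bar> \<le> \<theta> * n"
      using k[OF xy(1)] k[OF xy(2)] m(2) by linarith
    then have "\<bar>pair_walk U (?k x) \<omega> - pair_walk U (?k y) \<omega>\<bar> \<le> \<epsilon> * sqrt n"
      using k[OF xy(1)] k[OF xy(2)] a0[OF xy(1)] a0[OF xy(2)] by (intro mod) linarith+
    then have "C / sqrt n * \<bar>pair_walk U (?k x) \<omega> - pair_walk U (?k y) \<omega>\<bar> \<le> C / sqrt n * (\<epsilon> * sqrt n)"
      using c by (intro mult_left_mono) auto
    moreover have "\<bar>Z x - Z y\<bar> = C / sqrt n * \<bar>pair_walk U (?k x) \<omega> - pair_walk U (?k y) \<omega>\<bar>"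
      using c unfolding Z_def by (simp only: right_diff_distrib[symmetric] abs_mult abs_of_pos)
    ultimately show "\<bar>Z x - Z y\<bar> \<le> C * \<epsilon>" unfolding cn by simp
  qed
  with XZ show ?thesis by linarith
qed

end

subsection \<open>The invariance principle\<close>

lemma eventually_sqrt_le_linear:
  fixes a b c :: real
  assumes "a > 0" "b > 0" "c > 0"
  shows "eventually (\<lambda>n. a * sqrt (real n) + 2 * c \<le> b * real n) sequentially"
  using assms by real_asymp

locale alternating_renewal = prob_space M for M :: "'a measure" +
  fixes U :: "nat \<Rightarrow> 'a \<Rightarrow> real" and p C :: real
  assumes U_measurable: "\<And>k. k \<ge> 1 \<Longrightarrow> U k \<in> borel_measurable M"
    and U_indep: "indep_vars (\<lambda>_. borel) U {1..}"
    and U_distr: "\<And>k. k \<ge> 1 \<Longrightarrow> distr M borel (U k) = distr M borel (U 1)"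
    and U_nonneg: "\<And>k \<omega>. k \<ge> 1 \<Longrightarrow> \<omega> \<in> space M \<Longrightarrow> U k \<omega> \<ge> 0"
    and p: "p > 2" and U_powr: "integrable M (\<lambda>\<omega>. U 1 \<omega> powr p)"
    and C_pos: "C > 0" and C_square: "C\<^sup>2 = expectation (U 1) / variance (U 1)"
begin

definition \<mu> :: real where "\<mu> = expectation (U 1)"
definition \<sigma> :: real where "\<sigma> = sqrt (variance (U 1))"

lemma U1_measurable [measurable]: "U 1 \<in> borel_measurable M" "U (Suc 0) \<in> borel_measurable M"
  using U_measurable[of 1] by simp_all

lemma U1_square_integrable: "integrable M (\<lambda>\<omega>. (U 1 \<omega>)\<^sup>2)"
proof (rule Bochner_Integration.integrable_bound)
  show "integrable M (\<lambda>\<omega>. 1 + U 1 \<omega> powr p)" using U_powr by simp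
  show "AE \<omega> in M. norm ((U 1 \<omega>)\<^sup>2) \<le> norm (1 + U 1 \<omega> powr p)"
  proof (rule AE_I2)
    fix \<omega> assume "\<omega> \<in> space M"
    then have u: "U 1 \<omega> \<ge> 0" by (intro U_nonneg) auto
    have "(U 1 \<omega>)\<^sup>2 \<le> 1 + U 1 \<omega> powr p"
    proof (cases "U 1 \<omega> \<le> 1")
      case True
      then have "(U 1 \<omega>)\<^sup>2 \<le> 1" using u by (simp add: power_le_one)
      then show ?thesis by (simp add: add_increasing2)
    next
      case False
      then have "(U 1 \<omega>)\<^sup>2 = U 1 \<omega> powr 2" by simp
      also have "\<dots> \<le> U 1 \<omega> powr p" using False p by (intro powr_mono) auto
      finally show ?thesis by simp
    qed
    then show "norm ((U 1 \<omega>)\<^sup>2) \<le> norm (1 + U 1 \<omega> powr p)" by simp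
  qed
qed simp

lemma U1_integrable: "integrable M (U 1)"
  by (rule square_integrable_imp_integrable[OF _ U1_square_integrable]) simp

lemma \<mu>_\<sigma>: "\<mu> > 0" "\<sigma> > 0" "\<sigma>\<^sup>2 = variance (U 1)" "C\<^sup>2 * \<sigma>\<^sup>2 = \<mu>"
proof -
  have v: "variance (U 1) \<ge> 0" by (rule variance_positive)
  \<comment> \<open>As \<open>x / 0 = 0\<close>, a vanishing mean or variance would give
    \<open>C\<^sup>2 = 0\<close>, against \<open>C > 0\<close>.\<close>
  have nz: "variance (U 1) \<noteq> 0" "\<mu> \<noteq> 0" using C_pos C_square by (auto simp: \<mu>_def)
  have "variance (U 1) > 0" using v nz(1) by linarith
  then show s: "\<sigma> > 0" "\<sigma>\<^sup>2 = variance (U 1)"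
    using real_sqrt_pow2[OF v] unfolding \<sigma>_def by (simp_all only: real_sqrt_gt_0_iff)
  show "C\<^sup>2 * \<sigma>\<^sup>2 = \<mu>" unfolding s(2) C_square \<mu>_def using nz(1) by simp
  have "\<mu> \<ge> 0" unfolding \<mu>_def by (intro Bochner_Integration.integral_nonneg_AE AE_I2 U_nonneg) auto
  with nz show "\<mu> > 0" by simp
qed

lemma expectation_U:
  fixes f :: "real \<Rightarrow> real" assumes "k \<ge> 1" and [measurable]: "f \<in> borel_measurable borel"
  shows "expectation (\<lambda>\<omega>. f (U k \<omega>)) = expectation (\<lambda>\<omega>. f (U 1 \<omega>))"
proof -
  have [measurable]: "U k \<in> borel_measurable M" by (rule U_measurable) fact
  have "expectation (\<lambda>\<omega>. f (U k \<omega>)) = (\<integral>x. f x \<partial>distr M borel (U k))"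
    by (simp add: integral_distr)
  also have "distr M borel (U k) = distr M borel (U 1)" by (rule U_distr) fact
  also have "(\<integral>x. f x \<partial>distr M borel (U 1)) = expectation (\<lambda>\<omega>. f (U 1 \<omega>))"
    by (simp add: integral_distr)
  finally show ?thesis .
qed

lemma integrable_U:
  fixes f :: "real \<Rightarrow> real" assumes "k \<ge> 1" and [measurable]: "f \<in> borel_measurable borel"
    and int: "integrable M (\<lambda>\<omega>. f (U 1 \<omega>))"
  shows "integrable M (\<lambda>\<omega>. f (U k \<omega>))"
proof -
  have [measurable]: "U k \<in> borel_measurable M" by (rule U_measurable) fact
  have "integrable (distr M borel (U 1)) f" using int by (simp add: integrable_distr_eq)
  then have "integrable (distr M borel (U k)) f" using U_distr[OF \<open>k \<ge> 1\<close>] by simp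
  then show ?thesis by (simp add: integrable_distr_eq)
qed

lemma U_tail:
  assumes "k \<ge> 1" "x > 0"
  shows "prob {\<omega>\<in>space M. U k \<omega> > x} \<le> expectation (\<lambda>\<omega>. U 1 \<omega> powr p) / x powr p"
proof -
  have [measurable]: "U k \<in> borel_measurable M" by (rule U_measurable) fact
  have "prob {\<omega>\<in>space M. U k \<omega> > x} \<le> prob {\<omega>\<in>space M. U k \<omega> powr p \<ge> x powr p}"
    using assms p by (intro finite_measure_mono) (auto intro!: powr_mono2)
  also have "\<dots> \<le> expectation (\<lambda>\<omega>. U k \<omega> powr p) / x powr p"
  proof (rule integral_Markov_inequality_measure[where A="{}"])
    show "integrable M (\<lambda>\<omega>. U k \<omega> powr p)"
      by (rule integrable_U[where f="\<lambda>x. x powr p", OF assms(1) _ U_powr]) measurable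
  qed (use assms in auto)
  also have "expectation (\<lambda>\<omega>. U k \<omega> powr p) = expectation (\<lambda>\<omega>. U 1 \<omega> powr p)"
    by (rule expectation_U[where f="\<lambda>x. x powr p", OF assms(1)]) measurable
  finally show ?thesis .
qed

lemma pair_indep:
  assumes "a \<ge> 1" "b \<ge> 1" "a \<noteq> b"
  shows "indep_var borel (U a) borel (U b)"
proof -
  have "indep_var borel (U a) borel (\<lambda>\<omega>. \<Sum>i\<in>{b}. U i \<omega>)"
    using assms by (intro indep_vars_sum indep_vars_subset[OF U_indep]) auto
  then show ?thesis by simp
qed

text \<open>Taking \<open>c = -1\<close> gives the steps of the walk \<open>W\<close>, taking \<open>c = 1\<close> those of the centred
  epochs \<open>S\<^sub>2\<^sub>k - 2\<mu>k\<close>.\<close>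

lemma iid_centered_pairs:
  fixes c :: real
  assumes c: "c\<^sup>2 = 1"
  shows "iid_centered M (\<lambda>j \<omega>. (U (2*j+1) \<omega> - \<mu>) + c * (U (2*j+2) \<omega> - \<mu>)) (sqrt 2 * \<sigma>)"
proof
  let ?H = "\<lambda>j \<omega>. (U (2*j+1) \<omega> - \<mu>) + c * (U (2*j+2) \<omega> - \<mu>)"
  have [measurable]: "U (2*j+1) \<in> borel_measurable M" "U (2*j+2) \<in> borel_measurable M" for j
    by (rule U_measurable, simp)+
  show "indep_vars (\<lambda>_. borel) ?H UNIV"
  proof -
    let ?K = "\<lambda>j::nat. {2*j+1, 2*j+2}"
    have "disjoint_family_on ?K UNIV"
      unfolding disjoint_family_on_def by auto
    then have "indep_vars (\<lambda>j. PiM (?K j) (\<lambda>_. borel)) (\<lambda>j \<omega>. restrict (\<lambda>i. U i \<omega>) (?K j)) UNIV"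
      by (intro indep_vars_restrict[OF U_indep]) auto
    then have "indep_vars (\<lambda>_. borel) (\<lambda>j \<omega>. (restrict (\<lambda>i. U i \<omega>) (?K j) (2*j+1) - \<mu>) +
        c * (restrict (\<lambda>i. U i \<omega>) (?K j) (2*j+2) - \<mu>)) UNIV"
      by (rule indep_vars_compose2[where Y="\<lambda>j y. (y (2*j+1) - \<mu>) + c * (y (2*j+2) - \<mu>)"]) simp
    then show ?thesis by simp
  qed
  \<comment> \<open>The law of a step is an image of the joint law of its pair, and by independence
    this joint law is the same product measure for all \<open>k\<close>.\<close>
  have pd: "distr M (borel \<Otimes>\<^sub>M borel) (\<lambda>\<omega>. (U (2*k+1) \<omega>, U (2*k+2) \<omega>)) =
      distr M borel (U 1) \<Otimes>\<^sub>M distr M borel (U 1)" for k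
  proof -
    have "distr M borel (U (2*k+1)) \<Otimes>\<^sub>M distr M borel (U (2*k+2)) =
        distr M (borel \<Otimes>\<^sub>M borel) (\<lambda>\<omega>. (U (2*k+1) \<omega>, U (2*k+2) \<omega>))"
      using pair_indep[of "2*k+1" "2*k+2"] by (simp add: indep_var_distribution_eq)
    then show ?thesis using U_distr[of "2*k+1"] U_distr[of "2*k+2"] by simp
  qed
  have dH: "distr M borel (?H k) = distr (distr M borel (U 1) \<Otimes>\<^sub>M distr M borel (U 1)) borel
      (\<lambda>(x, y). (x - \<mu>) + c * (y - \<mu>))" for k
  proof -
    have "(\<lambda>\<omega>. (U (2*k+1) \<omega>, U (2*k+2) \<omega>)) \<in> M \<rightarrow>\<^sub>M borel \<Otimes>\<^sub>M borel" by measurable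
    then show ?thesis
      unfolding pd[of k, symmetric] by (subst distr_distr) (simp_all add: comp_def)
  qed
  show "distr M borel (?H k) = distr M borel (?H 0)" for k
    by (rule trans[OF dH dH[symmetric]])
  let ?X = "\<lambda>\<omega>. U 1 \<omega> - \<mu>" and ?Y = "\<lambda>\<omega>. U 2 \<omega> - \<mu>"
  have H0: "?H 0 = (\<lambda>\<omega>. ?X \<omega> + c * ?Y \<omega>)" by (simp add: numeral_2_eq_2)
  have U2[measurable]: "U 2 \<in> borel_measurable M" by (rule U_measurable) simp
  have iX: "integrable M ?X" using U1_integrable by simp
  have iY: "integrable M ?Y" by (rule integrable_U[where f="\<lambda>x. x - \<mu>", OF _ _ iX]) auto
  have iX2: "integrable M (\<lambda>\<omega>. (?X \<omega>)\<^sup>2)"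
    using U1_integrable U1_square_integrable by (simp add: power2_diff)
  have iY2: "integrable M (\<lambda>\<omega>. (?Y \<omega>)\<^sup>2)" by (rule integrable_U[where f="\<lambda>x. (x - \<mu>)\<^sup>2", OF _ _ iX2]) auto
  have eX: "expectation ?X = 0" using U1_integrable by (simp add: \<mu>_def prob_space)
  have eY: "expectation ?Y = 0" using expectation_U[of 2 "\<lambda>x. x - \<mu>"] eX by simp
  have eX2: "expectation (\<lambda>\<omega>. (?X \<omega>)\<^sup>2) = \<sigma>\<^sup>2" by (simp add: \<mu>_\<sigma>(3) \<mu>_def)
  have eY2: "expectation (\<lambda>\<omega>. (?Y \<omega>)\<^sup>2) = \<sigma>\<^sup>2" using expectation_U[of 2 "\<lambda>x. (x - \<mu>)\<^sup>2"] eX2 by simp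
  have ind: "indep_var borel ?X borel ?Y"
    using indep_var_compose[OF pair_indep[of 1 2], of "\<lambda>x. x - \<mu>" borel "\<lambda>x. x - \<mu>" borel]
    by (simp add: comp_def)
  note prod = indep_var_integrable[OF ind iX iY] indep_var_lebesgue_integral[OF ind iX iY]
  have sq: "(?H 0 \<omega>)\<^sup>2 = (?X \<omega>)\<^sup>2 + 2 * c * (?X \<omega> * ?Y \<omega>) + (?Y \<omega>)\<^sup>2" for \<omega>
  proof -
    have "(a + c * b)\<^sup>2 = a\<^sup>2 + 2 * c * (a * b) + b\<^sup>2" for a b :: real
      using c by (simp add: power2_sum power_mult_distrib)
    then show ?thesis unfolding fun_cong[OF H0, of \<omega>] .
  qed
  show "integrable M (\<lambda>\<omega>. (?H 0 \<omega>)\<^sup>2)"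
    unfolding sq by (intro Bochner_Integration.integrable_add integrable_mult_right iX2 iY2 prod)
  show "expectation (?H 0) = 0" unfolding H0 using iX iY eX eY
    by (simp only: Bochner_Integration.integral_add integrable_mult_right integral_mult_right) simp
  have "expectation (\<lambda>\<omega>. (?H 0 \<omega>)\<^sup>2) = \<sigma>\<^sup>2 + 2 * c * (expectation ?X * expectation ?Y) + \<sigma>\<^sup>2"
    unfolding sq using iX2 iY2 prod
    by (simp only: Bochner_Integration.integral_add Bochner_Integration.integrable_add
      integrable_mult_right integral_mult_right_zero eX2 eY2)
  then show "expectation (\<lambda>\<omega>. (?H 0 \<omega>)\<^sup>2) = (sqrt 2 * \<sigma>)\<^sup>2"
    unfolding eX by (simp add: power_mult_distrib)
  show "sqrt 2 * \<sigma> > 0" using \<mu>_\<sigma> by simp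
qed

section \<open>The two walks and the approximation of the process\<close>

sublocale diffs: iid_centered M "\<lambda>j \<omega>. U (2*j+1) \<omega> - U (2*j+2) \<omega>" "sqrt 2 * \<sigma>"
  using iid_centered_pairs[of "-1"] by (simp add: algebra_simps)

sublocale sums: iid_centered M "\<lambda>j \<omega>. U (2*j+1) \<omega> + U (2*j+2) \<omega> - 2 * \<mu>" "sqrt 2 * \<sigma>"
  using iid_centered_pairs[of 1] by (simp add: algebra_simps)

lemma diffs_W: "diffs.W k \<omega> = pair_walk U k \<omega>"
  unfolding diffs.W_def pair_walk_def by (rule refl)

lemma sums_W: "sums.W k \<omega> = renewal_S U (2 * k) \<omega> - 2 * \<mu> * k"
proof (induction k)
  case 0
  show ?case unfolding sums.W_def by (simp add: renewal_S_def)
next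
  case (Suc k)
  then show ?case unfolding sums.W_def by (simp add: renewal_S_Suc algebra_simps)
qed

text \<open>The random number of pairs completed by time \<open>n * t\<close> is replaced by its
  leading order \<open>n * t / (2 * \<mu>)\<close>, which makes the index deterministic.\<close>

definition scaled_walk :: "nat \<Rightarrow> 'a \<Rightarrow> real \<Rightarrow> real" where
  "scaled_walk n \<omega> t = C / sqrt n * pair_walk U (nat \<lfloor>1 / (2 * \<mu>) * (n * t)\<rfloor>) \<omega>"

text \<open>A union bound over order \<open>n\<close> waiting times, each exceeding the level with
  probability of order \<open>n powr (- p / 2)\<close> by Markov's inequality. The total is of order
  \<open>n powr (1 - p / 2)\<close>, which vanishes exactly because \<open>p > 2\<close>.\<close>

lemma large_step:
  assumes "\<epsilon> > 0" "\<eta> > 0"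
  shows "eventually (\<lambda>n. prob (\<Union>i\<in>{1..2 * nat \<lceil>1 / \<mu> * real n\<rceil>}. {\<omega>\<in>space M. U i \<omega> > \<epsilon> * sqrt n / 2}) \<le> \<eta>) sequentially"
proof -
  define E where "E = expectation (\<lambda>\<omega>. U 1 \<omega> powr p)"
  have E: "E \<ge> 0" unfolding E_def by simp
  define q where "q = p / 2 - 1"
  define b where "b = 1 / \<mu>"
  have q: "q > 0" and b: "b > 0" using p \<mu>_\<sigma>(1) by (simp_all add: q_def b_def)
  have "(\<lambda>n. real n powr - q) \<longlonglongrightarrow> 0"
    using q by (intro tendsto_neg_powr filterlim_real_sequentially) simp
  then have "(\<lambda>n. 2 * (E / (\<epsilon> / 2) powr p) * (real n powr - q * (b + 1 / real n))) \<longlonglongrightarrow> 2 * (E / (\<epsilon> / 2) powr p) * (0 * (b + 0))"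
    by (intro tendsto_mult tendsto_add tendsto_const lim_1_over_n)
  moreover have "eventually (\<lambda>n. 2 * (E / (\<epsilon> / 2) powr p) * (real n powr - q * (b + 1 / real n)) =
      2 * (1 / \<mu> * real n + 1) * (E / (\<epsilon> * sqrt n / 2) powr p)) sequentially"
    using eventually_gt_at_top[of 0]
  proof eventually_elim
    case (elim n)
    have "(\<epsilon> * sqrt n / 2) powr p = (\<epsilon> / 2) powr p * (real n powr (1/2)) powr p"
      using assms by (simp add: powr_mult[symmetric] powr_half_sqrt)
    also have "(real n powr (1/2)) powr p = real n powr q * real n"
      using elim by (simp add: powr_powr q_def powr_diff)
    finally show ?case using elim by (simp add: b_def powr_minus field_simps)
  qed
  ultimately have "(\<lambda>n. 2 * (1 / \<mu> * real n + 1) * (E / (\<epsilon> * sqrt n / 2) powr p)) \<longlonglongrightarrow> 0"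
    by (simp add: filterlim_cong)
  then have "eventually (\<lambda>n. 2 * (1 / \<mu> * real n + 1) * (E / (\<epsilon> * sqrt n / 2) powr p) < \<eta>) sequentially"
    using assms by (intro order_tendstoD(2)) auto
  then show ?thesis using eventually_gt_at_top[of 0]
  proof eventually_elim
    case (elim n)
    let ?K = "nat \<lceil>1 / \<mu> * real n\<rceil>" and ?x = "\<epsilon> * sqrt n / 2"
    have x: "?x > 0" using assms elim by simp
    have m: "{\<omega>\<in>space M. U i \<omega> > ?x} \<in> sets M" if "i \<in> {1..2 * ?K}" for i
    proof -
      have [measurable]: "U i \<in> borel_measurable M" using that by (intro U_measurable) auto
      show ?thesis by measurable
    qed
    have K: "real ?K \<le> 1 / \<mu> * n + 1"
    proof -
      have "0 \<le> 1 / \<mu> * real n" using \<mu>_\<sigma> by simp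
      then show ?thesis by linarith
    qed
    have "prob (\<Union>i\<in>{1..2 * ?K}. {\<omega>\<in>space M. U i \<omega> > ?x}) \<le> (\<Sum>i\<in>{1..2 * ?K}. prob {\<omega>\<in>space M. U i \<omega> > ?x})"
      using m by (intro finite_measure_subadditive_finite) auto
    also have "\<dots> \<le> (\<Sum>i\<in>{1..2 * ?K}. E / ?x powr p)"
      unfolding E_def using x by (intro sum_mono U_tail) auto
    also have "\<dots> = 2 * real ?K * (E / ?x powr p)" by simp
    also have "\<dots> \<le> 2 * (1 / \<mu> * n + 1) * (E / ?x powr p)"
      using K E by (intro mult_right_mono) auto
    finally show ?case using elim by linarith
  qed
qed

text \<open>The exceptional event unites three, each of probability at most
  \<open>\<eta> / 3\<close>: a bad modulus of the walk, a deviation of the even epochs, and a long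
  waiting time. \<open>m0\<close> does not depend on \<open>n\<close>; how large \<open>n\<close>
  must be may depend on \<open>m\<close>.\<close>

lemma telegraph_X_approx:
  assumes "\<epsilon> > 0" "\<eta> > 0"
  shows "\<exists>m0::nat. m0 > 0 \<and> (\<forall>m\<ge>m0. eventually (\<lambda>n. \<exists>A\<in>sets M. prob A \<le> \<eta> \<and>
    (\<forall>\<omega>\<in>space M - A. \<forall>t\<in>{0..1}.
       \<bar>telegraph_X U C n \<omega> t - linear_path m (grid_increments m (scaled_walk n \<omega>)) t\<bar> \<le> \<epsilon>)) sequentially)"
proof -
  note \<mu> = \<mu>_\<sigma>(1)
  define \<epsilon>' where "\<epsilon>' = \<epsilon> / (3 * C)"
  have \<epsilon>': "\<epsilon>' > 0" "3 * C * \<epsilon>' = \<epsilon>" using assms C_pos by (simp_all add: \<epsilon>'_def)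
  \<comment> \<open>Large enough that the index \<open>?K \<le> 1 / \<mu> * n + 1\<close> below is
    at most \<open>\<kappa> * n\<close> once \<open>n \<ge> 1\<close>.\<close>
  define \<kappa> where "\<kappa> = 1 / \<mu> + 1"
  have \<kappa>: "\<kappa> > 0" "1 / (2 * \<mu>) \<le> \<kappa>" using \<mu> by (simp_all add: \<kappa>_def add_pos_pos field_simps)
  have \<eta>: "\<eta> / 3 > 0" using assms by simp
  obtain \<theta> :: real where \<theta>: "\<theta> > 0" and mod: "eventually (\<lambda>n. \<exists>A\<in>sets M. prob A \<le> \<eta> / 3 \<and>
    (\<forall>\<omega>\<in>space M - A. \<forall>j k. real j \<le> \<kappa> * n \<longrightarrow> real k \<le> \<kappa> * n \<longrightarrow> \<bar>real j - real k\<bar> \<le> \<theta> * n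
       \<longrightarrow> \<bar>pair_walk U j \<omega> - pair_walk U k \<omega>\<bar> \<le> \<epsilon>' * sqrt n)) sequentially"
    using diffs.W_modulus[OF \<epsilon>'(1) \<kappa>(1) \<eta>] unfolding diffs_W by blast
  \<comment> \<open>\<open>\<delta> \<le> 1\<close> secures that the first \<open>?K\<close> pairs
    last beyond time \<open>n\<close>. The other bound keeps \<open>\<delta> * n\<close> to a
    quarter of the allowance \<open>2 * \<mu> * \<theta> * n\<close>, half of which goes to
    \<open>\<epsilon>' * sqrt n + 2 * \<mu>\<close>.\<close>
  define \<delta> where "\<delta> = min 1 (\<mu> * \<theta> / 2)"
  have \<delta>: "\<delta> > 0" "\<delta> \<le> 1" "\<delta> \<le> \<mu> * \<theta> / 2" using \<mu> \<theta> by (simp_all add: \<delta>_def)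
  \<comment> \<open>A cell then spans at most \<open>\<theta> / 2 * n\<close> steps; the other half
    of \<open>\<theta> * n\<close> covers the rounding error 1 for large \<open>n\<close>.\<close>
  define m0 where "m0 = nat \<lceil>1 / (\<mu> * \<theta>)\<rceil> + 1"
  show ?thesis
  proof (intro exI[of _ m0] conjI allI impI)
    show "m0 > 0" by (simp add: m0_def)
    fix m assume m: "m0 \<le> m"
    then have m_pos: "m > 0" by (simp add: m0_def)
    have "1 / (\<mu> * \<theta>) \<le> real m0" unfolding m0_def by linarith
    also have "\<dots> \<le> real m" using m by simp
    finally have "1 \<le> real m * (\<mu> * \<theta>)" using \<mu> \<theta> by (simp add: divide_le_eq)
    then have m2: "1 / (2 * \<mu>) * (n / m) \<le> \<theta> / 2 * n" for n :: nat
    proof -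
      have "real n * 1 \<le> real n * (real m * (\<mu> * \<theta>))"
        using \<open>1 \<le> real m * (\<mu> * \<theta>)\<close> by (intro mult_left_mono) auto
      then show ?thesis using \<mu> m_pos by (simp add: field_simps)
    qed
    have "1 / \<mu> > 0" using \<mu> by simp
    note lln = sums.W_uniform_LLN[OF \<delta>(1) this \<eta>, unfolded sums_W]
    have a1: "eventually (\<lambda>n. \<epsilon>' * sqrt (real n) + 2 * \<mu> \<le> \<mu> * \<theta> * n) sequentially"
    proof -
      define b where "b = \<mu> * \<theta>"
      have "b > 0" using \<mu> \<theta> by (simp add: b_def)
      from eventually_sqrt_le_linear[OF \<epsilon>'(1) this \<mu>]
      have "eventually (\<lambda>n. \<epsilon>' * sqrt (real n) + 2 * \<mu> \<le> b * n) sequentially" .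
      then show ?thesis by (simp add: b_def)
    qed
    have a2: "eventually (\<lambda>n. 1 \<le> \<theta> / 2 * real n) sequentially" using \<theta> by real_asymp
    show "eventually (\<lambda>n. \<exists>A\<in>sets M. prob A \<le> \<eta> \<and>
      (\<forall>\<omega>\<in>space M - A. \<forall>t\<in>{0..1}.
       \<bar>telegraph_X U C n \<omega> t - linear_path m (grid_increments m (scaled_walk n \<omega>)) t\<bar> \<le> \<epsilon>)) sequentially"
      using mod lln large_step[OF \<epsilon>'(1) \<eta>] a1 a2 eventually_gt_at_top[of 0]
    proof eventually_elim
      case (elim n)
      \<comment> \<open>Twice the expected number \<open>n / (2 * \<mu>)\<close> of pairs before
        time \<open>n\<close>: their mean length is at least \<open>2 * n\<close>, which survives a
        deviation of \<open>\<delta> * n \<le> n\<close>.\<close>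
      let ?K = "nat \<lceil>1 / \<mu> * real n\<rceil>"
      have nm: "1 / \<mu> * real n > 0" using \<mu> elim by simp
      have K: "?K > 0" "real ?K \<le> 1 / \<mu> * n + 1" "1 / \<mu> * n \<le> real ?K"
        using nm by linarith+
      have K1: "real ?K \<le> \<kappa> * n"
      proof -
        have "1 \<le> real n" using elim by simp
        with K(2) show ?thesis unfolding \<kappa>_def distrib_right by linarith
      qed
      have K2: "2 * \<mu> * real ?K - \<delta> * n \<ge> n"
      proof -
        have "\<mu> * (1 / \<mu> * n) \<le> \<mu> * real ?K" using \<mu> K by (intro mult_left_mono) auto
        moreover have "\<mu> * (1 / \<mu> * n) = n" using \<mu> by simp
        moreover have "\<delta> * real n \<le> 1 * real n" using \<delta> by (intro mult_right_mono) auto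
        ultimately show ?thesis by linarith
      qed
      have th: "\<delta> * n + \<epsilon>' * sqrt n + 2 * \<mu> \<le> 2 * \<mu> * \<theta> * n"
      proof -
        have "\<delta> * n \<le> \<mu> * \<theta> / 2 * n" using \<delta> by (intro mult_right_mono) auto
        moreover have "0 \<le> \<mu> * \<theta> * n" using \<mu> \<theta> by simp
        moreover have "\<mu> * \<theta> / 2 * n = (\<mu> * \<theta> * n) / 2" "2 * \<mu> * \<theta> * n = 2 * (\<mu> * \<theta> * n)" by simp_all
        ultimately show ?thesis using elim(4) by linarith
      qed
      have m3: "1 / (2 * \<mu>) * (n / m) + 1 \<le> \<theta> * n" using m2[of n] elim(5) by linarith
      obtain A1 where A1: "A1 \<in> sets M" "prob A1 \<le> \<eta> / 3" and
        mod': "\<And>\<omega> j k. \<omega> \<in> space M - A1 \<Longrightarrow> real j \<le> \<kappa> * n \<Longrightarrow> real k \<le> \<kappa> * n \<Longrightarrow> \<bar>real j - real k\<bar> \<le> \<theta> * n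
         \<Longrightarrow> \<bar>pair_walk U j \<omega> - pair_walk U k \<omega>\<bar> \<le> \<epsilon>' * sqrt n" using elim(1) by blast
      define A2 where "A2 = {\<omega>\<in>space M. \<exists>k\<le>?K. \<bar>renewal_S U (2 * k) \<omega> - 2 * \<mu> * k\<bar> > \<delta> * n}"
      define A3 where "A3 = (\<Union>i\<in>{1..2 * ?K}. {\<omega>\<in>space M. U i \<omega> > \<epsilon>' * sqrt n / 2})"
      have A2: "A2 \<in> sets M" "prob A2 \<le> \<eta> / 3"
      proof -
        have "{\<omega>\<in>space M. \<exists>k\<le>?K. \<bar>sums.W k \<omega>\<bar> > \<delta> * n} \<in> sets M" by measurable
        then show "A2 \<in> sets M" by (simp only: A2_def sums_W)
        show "prob A2 \<le> \<eta> / 3" using elim(2) by (simp only: A2_def)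
      qed
      have A3: "A3 \<in> sets M" "prob A3 \<le> \<eta> / 3"
      proof -
        have "{\<omega>\<in>space M. U i \<omega> > \<epsilon>' * sqrt n / 2} \<in> sets M" if "i \<in> {1..2 * ?K}" for i
        proof -
          have [measurable]: "U i \<in> borel_measurable M" using that by (intro U_measurable) auto
          show ?thesis by measurable
        qed
        then show "A3 \<in> sets M" unfolding A3_def by (intro sets.finite_UN) auto
        show "prob A3 \<le> \<eta> / 3" using elim(3) by (simp only: A3_def)
      qed
      show ?case
      proof (intro bexI[of _ "A1 \<union> A2 \<union> A3"] conjI ballI)
        have "prob (A1 \<union> A2 \<union> A3) \<le> prob (A1 \<union> A2) + prob A3"
          using A1 A2 A3 by (intro measure_Un_le) auto
        also have "prob (A1 \<union> A2) \<le> prob A1 + prob A2"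
          using A1 A2 by (intro measure_Un_le) auto
        finally show "prob (A1 \<union> A2 \<union> A3) \<le> \<eta>" using A1 A2 A3 by linarith
        show "A1 \<union> A2 \<union> A3 \<in> sets M" using A1 A2 A3 by auto
        fix \<omega> and t :: real assume w: "\<omega> \<in> space M - (A1 \<union> A2 \<union> A3)" and t: "t \<in> {0..1}"
        have "\<bar>telegraph_X U C n \<omega> t - linear_path m (grid_increments m
             (\<lambda>t::real. C / sqrt n * pair_walk U (nat \<lfloor>1 / (2 * \<mu>) * (n * t)\<rfloor>) \<omega>)) t\<bar> \<le> 3 * C * \<epsilon>'"
        proof (rule telegraph_X_linear_path_close[where \<kappa>=\<kappa> and \<delta>=\<delta> and \<theta>=\<theta> and K="?K"])
          show "k \<ge> 1 \<Longrightarrow> 0 \<le> U k \<omega>" for k using w by (intro U_nonneg) auto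
          show "k \<le> ?K \<Longrightarrow> \<bar>renewal_S U (2 * k) \<omega> - 2 * \<mu> * real k\<bar> \<le> \<delta> * real n" for k
            using w unfolding A2_def by force
          show "1 \<le> i \<Longrightarrow> i \<le> 2 * ?K \<Longrightarrow> U i \<omega> \<le> \<epsilon>' * sqrt n / 2" for i
            using w unfolding A3_def by force
          show "real j \<le> \<kappa> * n \<Longrightarrow> real k \<le> \<kappa> * n \<Longrightarrow> \<bar>real j - real k\<bar> \<le> \<theta> * n
             \<Longrightarrow> \<bar>pair_walk U j \<omega> - pair_walk U k \<omega>\<bar> \<le> \<epsilon>' * sqrt n" for j k
            using w by (intro mod') auto
        qed (use \<mu> K K1 K2 th \<kappa> C_pos m_pos m3 t elim in auto)
        then show "\<bar>telegraph_X U C n \<omega> t - linear_path m (grid_increments m (scaled_walk n \<omega>)) t\<bar> \<le> \<epsilon>"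
          unfolding \<epsilon>'(2) scaled_walk_def[abs_def] .
      qed
    qed
  qed
qed

section \<open>Passage to the limit\<close>

lemma scaled_walk_weak_limit:
  assumes F: "lip_functional F K L" and m: "m > 0"
    and B: "std_brownian_motion N B"
  shows "(\<lambda>n. \<integral>\<omega>. F (linear_path m (grid_increments m (scaled_walk n \<omega>))) \<partial>M) \<longlonglongrightarrow>
    (\<integral>\<omega>. F (linear_path m (grid_increments m (B \<omega>))) \<partial>N)"
proof -
  let ?\<tau> = "\<lambda>n i :: nat. nat \<lfloor>1 / (2 * \<mu>) * (n * (i / m))\<rfloor>"
  have N: "prob_space N" using B by (simp add: std_brownian_motion_def)
  have B_indep: "\<forall>(ts::nat \<Rightarrow> real) k. 0 \<le> ts 0 \<and> (\<forall>i<k. ts i < ts (Suc i)) \<and> ts k \<le> 1 \<longrightarrow>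
      prob_space.indep_vars N (\<lambda>_. borel) (\<lambda>i \<omega>. B \<omega> (ts (Suc i)) - B \<omega> (ts i)) {..<k}"
    and B_normal: "\<forall>s t. 0 \<le> s \<and> s < t \<and> t \<le> 1 \<longrightarrow>
      distributed N lborel (\<lambda>\<omega>. B \<omega> t - B \<omega> s) (\<lambda>x. ennreal (normal_density 0 (sqrt (t - s)) x))"
    using B unfolding std_brownian_motion_def by - (elim conjE, assumption)+
  have "(\<lambda>n. \<integral>\<omega>. F (linear_path m (\<lambda>i. C / sqrt n * (diffs.W (?\<tau> n (Suc i)) \<omega> - diffs.W (?\<tau> n i) \<omega>))) \<partial>M) \<longlonglongrightarrow>
    (\<integral>\<omega>. F (linear_path m (\<lambda>i. grid_increments m (B \<omega>) i)) \<partial>N)"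
  proof (rule diffs.W_increments_weak_limit[where G="\<lambda>d. F (linear_path m d)" and E="\<lambda>i \<omega>. grid_increments m (B \<omega>) i" and K=K])
    \<comment> \<open>The rate is \<open>a = 1 / (2 * \<mu>)\<close> pairs per unit time; with step
      variance \<open>2\<sigma>\<^sup>2\<close> the next goal is the relation
      \<open>C\<^sup>2 * \<sigma>\<^sup>2 = \<mu>\<close>.\<close>
    show "1 / (2 * \<mu>) > 0" "C > 0" "m > 0" using \<mu>_\<sigma> C_pos m by simp_all
    show "C\<^sup>2 * (sqrt 2 * \<sigma>)\<^sup>2 * (1 / (2 * \<mu>)) = 1"
      using \<mu>_\<sigma> by (simp add: power_mult_distrib)
    show "prob_space N" by (rule N)
    have "prob_space.indep_vars N (\<lambda>_. borel)
        (\<lambda>i \<omega>. B \<omega> (real (Suc i) / real m) - B \<omega> (real i / real m)) {..<m}"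
      by (rule B_indep[rule_format, of "\<lambda>i. real i / real m"])
        (use m in \<open>auto simp: divide_strict_right_mono\<close>)
    then show "prob_space.indep_vars N (\<lambda>_. borel) (\<lambda>i \<omega>. grid_increments m (B \<omega>) i) {..<m}"
      by (simp only: grid_increments_def)
    show "distributed N lborel (\<lambda>\<omega>. grid_increments m (B \<omega>) i) (\<lambda>x. ennreal (normal_density 0 (sqrt (1 / m)) x))"
      if i: "i < m" for i
    proof -
      have "0 \<le> real i / m" "real i / m < real (Suc i) / m" "real (Suc i) / m \<le> 1"
        using i by (auto simp: divide_strict_right_mono)
      then have "distributed N lborel (\<lambda>\<omega>. B \<omega> (real (Suc i) / m) - B \<omega> (real i / m))
          (\<lambda>x. ennreal (normal_density 0 (sqrt (real (Suc i) / m - real i / m)) x))"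
        by (intro B_normal[rule_format]) simp
      also have "real (Suc i) / m - real i / m = 1 / m" by (simp add: diff_divide_distrib[symmetric])
      finally show ?thesis by (simp only: grid_increments_def)
    qed
    show "\<bar>F (linear_path m x)\<bar> \<le> K" for x
      using F continuous_linear_path[of "{0..1}" m x] unfolding lip_functional_def by blast
    show "(\<And>i. i < m \<Longrightarrow> (\<lambda>n. x n i) \<longlonglongrightarrow> y i) \<Longrightarrow> (\<lambda>n. F (linear_path m (x n))) \<longlonglongrightarrow> F (linear_path m y)" for x y
      by (rule functional_linear_path_tendsto[OF lip_functional_bounded_cont[OF F]])
  qed
  moreover have "(\<lambda>i. C / sqrt n * (diffs.W (?\<tau> n (Suc i)) \<omega> - diffs.W (?\<tau> n i) \<omega>)) =
      grid_increments m (scaled_walk n \<omega>)" for n \<omega>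
    by (simp only: fun_eq_iff grid_increments_def scaled_walk_def diffs_W right_diff_distrib simp_thms)
  ultimately show ?thesis by simp
qed

text \<open>The error \<open>e\<close> is split in three: \<open>e/2\<close> from the process to the
  interpolated walk, \<open>e/4\<close> from there to the interpolated Brownian motion,
  \<open>e/4\<close> from the latter to Brownian motion.\<close>

lemma telegraph_X_weak_limit:
  assumes F: "lip_functional F K L" and B: "std_brownian_motion N B"
  shows "(\<lambda>n. \<integral>\<omega>. F (telegraph_X U C n \<omega>) \<partial>M) \<longlonglongrightarrow> (\<integral>\<omega>. F (B \<omega>) \<partial>N)"
proof (rule tendstoI)
  fix e :: real assume e: "e > 0"
  interpret N: prob_space N using B by (simp add: std_brownian_motion_def)
  note Fb = lip_functional_bounded_cont[OF F]
  have L: "L \<ge> 0" using F by (simp add: lip_functional_def)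
  have FK: "\<bar>F f\<bar> \<le> K" if "continuous_on {0..1} f" for f
    using F that by (auto simp: lip_functional_def)
  have K: "K \<ge> 0" using FK[of "\<lambda>_. 0"] by simp
  have BP: "C01_process N B" using B by (auto simp: C01_process_def std_brownian_motion_def)
  have XP: "C01_process M (telegraph_X U C n)" for n by (rule telegraph_X_process[OF U_measurable])
  \<comment> \<open>Chosen so that \<open>L * \<epsilon>\<close> and \<open>2 * K * \<eta>\<close>
    are each at most \<open>e/4\<close>; the added 1 guards against \<open>L = 0\<close> or
    \<open>K = 0\<close>.\<close>
  define \<epsilon> where "\<epsilon> = e / (4 * (L + 1))"
  define \<eta> where "\<eta> = e / (8 * (K + 1))"
  have \<epsilon>\<eta>: "\<epsilon> > 0" "\<eta> > 0" using e L K by (simp_all add: \<epsilon>_def \<eta>_def)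
  have small: "L * \<epsilon> + 2 * K * \<eta> \<le> e / 2"
  proof -
    have "L * \<epsilon> \<le> (L + 1) * \<epsilon>" "2 * K * \<eta> \<le> 2 * (K + 1) * \<eta>" using \<epsilon>\<eta> by simp_all
    moreover have "(L + 1) * \<epsilon> = e / 4" "2 * (K + 1) * \<eta> = e / 4"
      using L K by (simp_all add: \<epsilon>_def \<eta>_def field_simps)
    ultimately show ?thesis by linarith
  qed
  have "(\<lambda>m. \<integral>\<omega>. F (linear_path m (grid_increments m (B \<omega>))) \<partial>N) \<longlonglongrightarrow> (\<integral>\<omega>. F (B \<omega>) \<partial>N)"
  proof (rule integral_dominated_convergence[where w="\<lambda>_. K"])
    show "AE \<omega> in N. (\<lambda>m. F (linear_path m (grid_increments m (B \<omega>)))) \<longlonglongrightarrow> F (B \<omega>)"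
      by (intro AE_I2 functional_linear_path_limit[OF Fb BP])
    show "(\<lambda>\<omega>. F (linear_path m (grid_increments m (B \<omega>)))) \<in> borel_measurable N" for m
      by (rule measurable_functional_grid[OF Fb BP])
    show "(\<lambda>\<omega>. F (B \<omega>)) \<in> borel_measurable N" by (rule measurable_functional[OF Fb BP])
    show "AE \<omega> in N. norm (F (linear_path m (grid_increments m (B \<omega>)))) \<le> K" for m
      using FK[OF continuous_linear_path] by simp
  qed simp
  then have "eventually (\<lambda>m. dist (\<integral>\<omega>. F (linear_path m (grid_increments m (B \<omega>))) \<partial>N) (\<integral>\<omega>. F (B \<omega>) \<partial>N) < e / 4) sequentially"
    using e by (intro tendstoD) auto
  moreover obtain m0 where "m0 > 0" and m0: "\<And>m. m \<ge> m0 \<Longrightarrow> eventually (\<lambda>n. \<exists>A\<in>sets M. prob A \<le> \<eta> \<and>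
    (\<forall>\<omega>\<in>space M - A. \<forall>t\<in>{0..1}.
       \<bar>telegraph_X U C n \<omega> t - linear_path m (grid_increments m (scaled_walk n \<omega>)) t\<bar> \<le> \<epsilon>)) sequentially"
    using telegraph_X_approx[OF \<epsilon>\<eta>] by blast
  ultimately have "eventually (\<lambda>m. m \<ge> m0 \<and>
      dist (\<integral>\<omega>. F (linear_path m (grid_increments m (B \<omega>))) \<partial>N) (\<integral>\<omega>. F (B \<omega>) \<partial>N) < e / 4) sequentially"
    by (intro eventually_conj eventually_ge_at_top)
  \<comment> \<open>The mesh is fixed here, fine enough both for the Brownian paths and for the
    approximation of the process; from now on only \<open>n\<close> varies.\<close>
  then obtain m where m: "m \<ge> m0"
    and mB: "dist (\<integral>\<omega>. F (linear_path m (grid_increments m (B \<omega>))) \<partial>N) (\<integral>\<omega>. F (B \<omega>) \<partial>N) < e / 4"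
    using eventually_happens'[OF sequentially_bot] by blast
  have m_pos: "m > 0" using m \<open>m0 > 0\<close> by simp
  have "eventually (\<lambda>n. dist (\<integral>\<omega>. F (linear_path m (grid_increments m (scaled_walk n \<omega>))) \<partial>M)
      (\<integral>\<omega>. F (linear_path m (grid_increments m (B \<omega>))) \<partial>N) < e / 4) sequentially"
    using e by (intro tendstoD[OF scaled_walk_weak_limit[OF F m_pos B]]) auto
  then show "eventually (\<lambda>n. dist (\<integral>\<omega>. F (telegraph_X U C n \<omega>) \<partial>M) (\<integral>\<omega>. F (B \<omega>) \<partial>N) < e) sequentially"
    using m0[OF m]
  proof eventually_elim
    case (elim n)
    let ?Z = "\<lambda>\<omega>. linear_path m (grid_increments m (scaled_walk n \<omega>))"
    obtain A where A: "A \<in> sets M" "prob A \<le> \<eta>" and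
      close: "\<And>\<omega>. \<omega> \<in> space M - A \<Longrightarrow> \<forall>t\<in>{0..1}. \<bar>telegraph_X U C n \<omega> t - ?Z \<omega> t\<bar> \<le> \<epsilon>"
      using elim(2) by blast
    have Zm: "(\<lambda>\<omega>. F (?Z \<omega>)) \<in> borel_measurable M"
    proof (rule measurable_functional_linear_path[OF Fb, where D="\<lambda>\<omega>. grid_increments m (scaled_walk n \<omega>)"])
      show "(\<lambda>\<omega>. grid_increments m (scaled_walk n \<omega>) i) \<in> borel_measurable M" for i
        unfolding grid_increments_def scaled_walk_def diffs_W[symmetric] by measurable
    qed
    have iZ: "integrable M (\<lambda>\<omega>. F (?Z \<omega>))"
      using FK[OF continuous_linear_path] by (intro integrable_const_bound[where B=K] Zm AE_I2) auto
    have iX: "integrable M (\<lambda>\<omega>. F (telegraph_X U C n \<omega>))"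
      by (rule integrable_functional[OF prob_space_axioms Fb XP])
    have "\<bar>(\<integral>\<omega>. F (telegraph_X U C n \<omega>) \<partial>M) - (\<integral>\<omega>. F (?Z \<omega>) \<partial>M)\<bar> =
        \<bar>\<integral>\<omega>. F (telegraph_X U C n \<omega>) - F (?Z \<omega>) \<partial>M\<bar>" using iX iZ by simp
    also have "\<dots> \<le> (\<integral>\<omega>. \<bar>F (telegraph_X U C n \<omega>) - F (?Z \<omega>)\<bar> \<partial>M)" by (rule integral_abs_bound)
    \<comment> \<open>Off \<open>A\<close> the paths are uniformly \<epsilon>-close and the
      Lipschitz bound applies; on \<open>A\<close> only the bound \<open>K\<close> on both values is
      available.\<close>
    also have "\<dots> \<le> (\<integral>\<omega>. L * \<epsilon> + 2 * K * indicator A \<omega> \<partial>M)"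
    proof (rule integral_mono)
      show "integrable M (\<lambda>\<omega>. \<bar>F (telegraph_X U C n \<omega>) - F (?Z \<omega>)\<bar>)" using iX iZ by simp
      show "integrable M (\<lambda>\<omega>. L * \<epsilon> + 2 * K * indicator A \<omega>)"
        using A by (intro Bochner_Integration.integrable_add integrable_mult_right integrable_real_indicator)
          (auto simp: emeasure_eq_measure)
      fix \<omega> assume w: "\<omega> \<in> space M"
      have cX: "continuous_on {0..1} (telegraph_X U C n \<omega>)" using XP[of n] w by (simp add: C01_process_def)
      show "\<bar>F (telegraph_X U C n \<omega>) - F (?Z \<omega>)\<bar> \<le> L * \<epsilon> + 2 * K * indicator A \<omega>"
      proof (cases "\<omega> \<in> A")
        case True
        have "\<bar>F (telegraph_X U C n \<omega>)\<bar> \<le> K" "\<bar>F (?Z \<omega>)\<bar> \<le> K"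
          by (rule FK[OF cX], rule FK[OF continuous_linear_path])
        moreover have "0 \<le> L * \<epsilon>" using L \<epsilon>\<eta> by simp
        ultimately show ?thesis using True by simp
      next
        case False
        then have "\<bar>F (telegraph_X U C n \<omega>) - F (?Z \<omega>)\<bar> \<le> L * \<epsilon>"
          using F cX continuous_linear_path close[of \<omega>] w unfolding lip_functional_def by blast
        then show ?thesis using False by simp
      qed
    qed
    also have "\<dots> = L * \<epsilon> + 2 * K * prob A"
      using A by (subst Bochner_Integration.integral_add) (auto simp: prob_space emeasure_eq_measure)
    also have "\<dots> \<le> L * \<epsilon> + 2 * K * \<eta>" using A K by (intro add_left_mono mult_left_mono) auto
    also have "\<dots> \<le> e / 2" by (rule small)
    finally have "dist (\<integral>\<omega>. F (telegraph_X U C n \<omega>) \<partial>M) (\<integral>\<omega>. F (?Z \<omega>) \<partial>M) \<le> e / 2"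
      by (simp add: dist_real_def)
    with elim(1) mB show ?case unfolding dist_real_def by linarith
  qed
qed

lemma telegraph_X_weak_conv:
  assumes B: "std_brownian_motion N B"
  shows "weak_conv_C01 M (\<lambda>n. telegraph_X U C n) N B"
proof (rule weak_conv_C01I)
  show "prob_space N" "C01_process N B" using B by (auto simp: C01_process_def std_brownian_motion_def)
  show "C01_process M (telegraph_X U C n)" for n by (rule telegraph_X_process[OF U_measurable])
qed (use prob_space_axioms telegraph_X_weak_limit[OF _ B] in auto)

end

theorem theorem1:
  fixes M :: "'a measure" and U :: "nat \<Rightarrow> 'a \<Rightarrow> real" and p C :: real
  assumes "prob_space M"
    and "\<And>k. k \<ge> 1 \<Longrightarrow> U k \<in> borel_measurable M"
    and "prob_space.indep_vars M (\<lambda>_. borel) U {1..}"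
    and "\<And>k. k \<ge> 1 \<Longrightarrow> distr M borel (U k) = distr M borel (U 1)"
    and "\<And>k \<omega>. k \<ge> 1 \<Longrightarrow> \<omega> \<in> space M \<Longrightarrow> U k \<omega> \<ge> 0"
    and "measure M {\<omega> \<in> space M. U 1 \<omega> = 0} < 1"
    and "p > 2" and "integrable M (\<lambda>\<omega>. U 1 \<omega> powr p)"
    and "C > 0"
    and "C\<^sup>2 = prob_space.expectation M (U 1) / prob_space.variance M (U 1)"
  shows "\<forall>(N :: 'b measure) B. std_brownian_motion N B \<longrightarrow>
           weak_conv_C01 M (\<lambda>n. telegraph_X U C n) N B"
proof -
  interpret alternating_renewal M U p C
    by (intro alternating_renewal.intro alternating_renewal_axioms.intro assms)
  show ?thesis by (intro allI impI telegraph_X_weak_conv)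
qed

end
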